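(* Let $l\ge4$ and let $\mathfrak{g}$ be a finite-dimensional real solvable Lie algebra whose nilradical $\mathfrak{n}$ is the standard filiform Lie algebra $L_l$, with basis $X_1,\dots,X_l$ as in its definition, and let $\mathfrak{i}=\operatorname{Span}(X_2,\dots,X_l)$. Define the one-forms $\lambda$ and $\iota$ on $\mathfrak{g}$ by $[Y,X_l]=\lambda(Y)X_l$ and $\iota(Y)=\operatorname{Tr}\big((\operatorname{ad}_Y)_{|\mathfrak{i}}\big)$ for $Y\in\mathfrak{g}$. Then $\mathfrak{g}$ admits an inner product of negative Ricci curvature if and only if there exists $Y\in\mathfrak{g}$ such that $\lambda(Y)>0$ and $\iota(Y)>0$.
   Context: The nilradical of $\mathfrak{g}$ is its maximal nilpotent ideal. The standard filiform Lie algebra $L_l$ is the $l$-dimensional real Lie algebra having a basis $X_1,\dots,X_l$ such that $[X_1,X_i]=X_{i+1}$ for $i=2,\dots,l-1$, $[X_1,X_l]=0$, and $[X_i,X_j]=0$ for $i,j\ge2$. For $l\ge4$, $\mathfrak{i}=\operatorname{Span}(X_2,\dots,X_l)$ is the unique codimension one abelian ideal of $L_l$ and $\mathbb{R}X_l$ is its centre; both are invariant under every derivation of $L_l$, so $\lambda$ and $\iota$ are well defined. Ricci curvature: given an inner product $\langle\cdot,\cdot\rangle$ on a finite-dimensional real Lie algebra $\mathfrak{g}$, let $B$ be the Killing form of $\mathfrak{g}$, let $H\in\mathfrak{g}$ be defined by $\langle H,X\rangle=\operatorname{Tr}\operatorname{ad}_X$ for all $X\in\mathfrak g$, and let $\{E_i\}$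 be any orthonormal basis of $(\mathfrak{g},\langle\cdot,\cdot\rangle)$. The Ricci curvature of the metric Lie algebra $(\mathfrak{g},\langle\cdot,\cdot\rangle)$ is the quadratic form $$\mathrm{ric}(X)=-\langle[H,X],X\rangle-\tfrac12 B(X,X)-\tfrac12\sum_i\|[X,E_i]\|^2+\tfrac14\sum_{i,j}\langle[E_i,E_j],X\rangle^2 ,\quad X\in\mathfrak g$$ (this is the Ricci curvature at the identity of the corresponding left-invariant metric on a Lie group with Lie algebra $\mathfrak{g}$). The inner product $\langle\cdot,\cdot\rangle$ is said to be of negative Ricci curvature if $\mathrm{ric}(X)<0$ for all $X\ne0$. *)

theory Defs
  imports "HOL-Analysis.Analysis"
begin

text \<open>A Lie algebra is a real vector space type \<open>'a\<close> together with a bracket on all of \<open>'a\<close>;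
  subalgebras and ideals are sets. Inner products on the Lie algebra are explicit functions, since
  they are quantified over.\<close>

definition lie_bracket :: "('a::real_vector \<Rightarrow> 'a \<Rightarrow> 'a) \<Rightarrow> bool" where
  "lie_bracket br \<longleftrightarrow> bilinear br \<and> (\<forall>x. br x x = 0) \<and>
     (\<forall>x y z. br x (br y z) + br y (br z x) + br z (br x y) = 0)"

definition bracket_span :: "('a::real_vector \<Rightarrow> 'a \<Rightarrow> 'a) \<Rightarrow> 'a set \<Rightarrow> 'a set \<Rightarrow> 'a set" where
  "bracket_span br A B = span {br x y | x y. x \<in> A \<and> y \<in> B}"

definition lie_ideal :: "('a::real_vector \<Rightarrow> 'a \<Rightarrow> 'a) \<Rightarrow> 'a set \<Rightarrow> bool" where
  "lie_ideal br I \<longleftrightarrow> subspace I \<and> (\<forall>x. \<forall>y\<in>I. br x y \<in> I)"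

primrec derived_series :: "('a::real_vector \<Rightarrow> 'a \<Rightarrow> 'a) \<Rightarrow> 'a set \<Rightarrow> nat \<Rightarrow> 'a set" where
  "derived_series br A 0 = A"
| "derived_series br A (Suc k) = bracket_span br (derived_series br A k) (derived_series br A k)"

primrec lower_central_series :: "('a::real_vector \<Rightarrow> 'a \<Rightarrow> 'a) \<Rightarrow> 'a set \<Rightarrow> nat \<Rightarrow> 'a set" where
  "lower_central_series br A 0 = A"
| "lower_central_series br A (Suc k) = bracket_span br A (lower_central_series br A k)"

definition lie_solvable :: "('a::real_vector \<Rightarrow> 'a \<Rightarrow> 'a) \<Rightarrow> 'a set \<Rightarrow> bool" where
  "lie_solvable br A \<longleftrightarrow> (\<exists>k. derived_series br A k = {0})"

definition lie_nilpotent :: "('a::real_vector \<Rightarrow> 'a \<Rightarrow> 'a) \<Rightarrow> 'a set \<Rightarrow> bool" where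
  "lie_nilpotent br A \<longleftrightarrow> (\<exists>k. lower_central_series br A k = {0})"

text \<open>Maximality is with respect to inclusion; in finite dimension sums of nilpotent ideals are
  nilpotent, so there is exactly one such \<open>N\<close>.\<close>

definition is_nilradical :: "('a::real_vector \<Rightarrow> 'a \<Rightarrow> 'a) \<Rightarrow> 'a set \<Rightarrow> bool" where
  "is_nilradical br N \<longleftrightarrow> lie_ideal br N \<and> lie_nilpotent br N \<and>
     (\<forall>M. lie_ideal br M \<and> lie_nilpotent br M \<and> N \<subseteq> M \<longrightarrow> M = N)"

text \<open>The basis vectors are \<open>X 1, \<dots>, X l\<close>; other values of \<open>X\<close> are irrelevant.\<close>

definition standard_filiform_basis ::
  "('a::real_vector \<Rightarrow> 'a \<Rightarrow> 'a) \<Rightarrow> 'a set \<Rightarrow> nat \<Rightarrow> (nat \<Rightarrow> 'a) \<Rightarrow> bool" where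
  "standard_filiform_basis br N l X \<longleftrightarrow>
     inj_on X {1..l} \<and> independent (X ` {1..l}) \<and> span (X ` {1..l}) = N \<and>
     (\<forall>i\<in>{2..l-1}. br (X 1) (X i) = X (i + 1)) \<and> br (X 1) (X l) = 0 \<and>
     (\<forall>i\<in>{2..l}. \<forall>j\<in>{2..l}. br (X i) (X j) = 0)"

text \<open>Trace of the restriction to \<open>V\<close> of a linear map preserving the finite-dimensional subspace
  \<open>V\<close>; the value does not depend on the chosen basis of \<open>V\<close>.\<close>

definition trace_on :: "'a::real_vector set \<Rightarrow> ('a \<Rightarrow> 'a) \<Rightarrow> real" where
  "trace_on V f =
     (let B = (SOME B. independent B \<and> span B = V) in \<Sum>b\<in>B. representation B (f b) b)"

definition centre_weight :: "('a::real_vector \<Rightarrow> 'a \<Rightarrow> 'a) \<Rightarrow> nat \<Rightarrow> (nat \<Rightarrow> 'a) \<Rightarrow> 'a \<Rightarrow> real" where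
  "centre_weight br l X Y = (THE c. br Y (X l) = c *\<^sub>R X l)"

definition ideal_trace :: "('a::real_vector \<Rightarrow> 'a \<Rightarrow> 'a) \<Rightarrow> nat \<Rightarrow> (nat \<Rightarrow> 'a) \<Rightarrow> 'a \<Rightarrow> real" where
  "ideal_trace br l X Y = trace_on (span (X ` {2..l})) (br Y)"

definition inner_product :: "('a::real_vector \<Rightarrow> 'a \<Rightarrow> real) \<Rightarrow> bool" where
  "inner_product ip \<longleftrightarrow> bilinear ip \<and> (\<forall>x y. ip x y = ip y x) \<and> (\<forall>x. x \<noteq> 0 \<longrightarrow> ip x x > 0)"

definition orthonormal_basis :: "('a::real_vector \<Rightarrow> 'a \<Rightarrow> real) \<Rightarrow> 'a set \<Rightarrow> bool" where
  "orthonormal_basis ip E \<longleftrightarrow>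
     span E = UNIV \<and> (\<forall>u\<in>E. \<forall>v\<in>E. ip u v = (if u = v then 1 else 0))"

definition killing_form :: "('a::real_vector \<Rightarrow> 'a \<Rightarrow> 'a) \<Rightarrow> 'a \<Rightarrow> 'a \<Rightarrow> real" where
  "killing_form br x y = trace_on UNIV (\<lambda>z. br x (br y z))"

definition trace_vector :: "('a::real_vector \<Rightarrow> 'a \<Rightarrow> 'a) \<Rightarrow> ('a \<Rightarrow> 'a \<Rightarrow> real) \<Rightarrow> 'a" where
  "trace_vector br ip = (THE H. \<forall>x. ip H x = trace_on UNIV (br x))"

text \<open>The Ricci form does not depend on the chosen orthonormal basis; \<open>ip v v\<close> is the squared norm.\<close>

definition ricci :: "('a::real_vector \<Rightarrow> 'a \<Rightarrow> 'a) \<Rightarrow> ('a \<Rightarrow> 'a \<Rightarrow> real) \<Rightarrow> 'a \<Rightarrow> real" where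
  "ricci br ip x =
     (let H = trace_vector br ip; E = (SOME E. orthonormal_basis ip E) in
        - ip (br H x) x - 1/2 * killing_form br x x
        - 1/2 * (\<Sum>e\<in>E. ip (br x e) (br x e))
        + 1/4 * (\<Sum>e\<in>E. \<Sum>f\<in>E. (ip (br e f) x)\<^sup>2))"

definition negative_ricci :: "('a::real_vector \<Rightarrow> 'a \<Rightarrow> 'a) \<Rightarrow> ('a \<Rightarrow> 'a \<Rightarrow> real) \<Rightarrow> bool" where
  "negative_ricci br ip \<longleftrightarrow> (\<forall>x. x \<noteq> 0 \<longrightarrow> ricci br ip x < 0)"

end

theory Submission
  imports Defs
begin

text \<open>
  Necessity rests on one estimate. Let \<open>A\<close> be an abelian ideal and sum the Ricci form over an
  orthonormal basis of \<open>A\<close>. The Killing term vanishes because \<open>ad\<^sup>2 = 0\<close> for elements of \<open>A\<close>, the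
  negative term in the squared norms of \<open>[e, f]\<close> is cancelled by those summands of the positive
  quadratic term with exactly one of the two basis vectors in \<open>A\<close>, and what is left is at least
  \<open>- Tr (ad H | A)\<close>. Negative curvature therefore forces \<open>Tr (ad H | A) > 0\<close>
  (\<open>negative_ricci_abelian_ideal\<close>), and the mean curvature vector \<open>Y = H\<close> serves for both abelian
  ideals: the centre of the nilradical and its abelian ideal of codimension one.

  For sufficiency, every \<open>ad Y\<close> acts on the basis \<open>X 1, \<dots>, X l\<close> by a triangular matrix whose
  diagonal entries are \<open>a, b, b + a, \<dots>, b + (l - 2) a\<close>; they are linear forms in \<open>Y\<close>, called
  weights below. The weights vanish on brackets, and they vanish simultaneously only on the
  nilradical, since otherwise some term of the derived series would produce a larger nilpotent ideal
  (\<open>weights_zero_imp_N\<close>). Consequently, once \<open>X i\<close> is given degree \<open>i\<close> and a complement of the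
  nilradical degree \<open>0\<close>, a bracket of basis vectors of degrees \<open>p\<close> and \<open>q\<close> has components in degrees
  at least \<open>p + q\<close> only. Scaling a basis vector of degree \<open>w\<close>
  by a multiple of \<open>\<epsilon> ^ w\<close> and letting \<open>\<epsilon>\<close> tend to \<open>0\<close> makes the structure constants converge to
  those of the associated graded algebra, in which the complement acts diagonally and commutes.
  Negative definiteness is an open condition on structure constants, so it is enough to make
  the graded model negative (\<open>negative_ricci_degeneration\<close>).

  The scaling leaves the brackets \<open>[X 1, X i] = \<mu> i X (i + 1)\<close> with \<open>\<mu> i > 0\<close> at our disposal, and
  an orthonormal basis of the complement that consists of \<open>Y\<close> and of vectors with traceless adjoint
  makes \<open>H\<close> a multiple of \<open>Y\<close>. The Ricci form of the model is then a combination of squares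
  (\<open>ricci_form_filiform_constants\<close>), and its negativity amounts to inequalities that
  are linear in \<open>\<mu> i ^ 2\<close>. The partial sums of these inequalities telescope to tails
  \<open>b + k a + \<dots> + b + (l - 2) a\<close> of the weight sequence. A tail is positive because its average lies
  between the last weight \<open>\<lambda>(Y) > 0\<close> and the average of all of them, which is a positive multiple of
  \<open>\<iota>(Y)\<close> (\<open>filiform_weights_feasible\<close>).
\<close>

section \<open>Dual families, coordinates and traces\<close>

text \<open>Linear forms dual to a family make the family a basis of its span and read off its coordinates.
  Working with a dual family avoids carrying \<open>representation\<close>, which is linear only on the span.\<close>

lemma dual_family_representation:
  fixes e :: "'i \<Rightarrow> 'a::real_vector"
  assumes fin: "finite I"
    and lin: "\<And>i. i \<in> I \<Longrightarrow> linear (\<phi> i)"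
    and dual: "\<And>i j. i \<in> I \<Longrightarrow> j \<in> I \<Longrightarrow> \<phi> i (e j) = (if i = j then 1 else (0::real))"
  shows dual_family_inj: "inj_on e I"
    and dual_family_independent: "independent (e ` I)"
    and dual_family_expansion: "\<And>x. x \<in> span (e ` I) \<Longrightarrow> (\<Sum>i\<in>I. \<phi> i x *\<^sub>R e i) = x"
    and dual_family_coordinate:
      "\<And>x i. x \<in> span (e ` I) \<Longrightarrow> i \<in> I \<Longrightarrow> representation (e ` I) x (e i) = \<phi> i x"
proof -
  show inj: "inj_on e I"
    using dual by (metis inj_onI zero_neq_one)
  have coord: "\<phi> i (\<Sum>j\<in>I. c j *\<^sub>R e j) = c i" if "i \<in> I" for i c
  proof -
    have "\<phi> i (\<Sum>j\<in>I. c j *\<^sub>R e j) = (\<Sum>j\<in>I. c j * \<phi> i (e j))"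
      using lin[OF that] by (simp add: linear_sum linear_scale)
    also have "\<dots> = (\<Sum>j\<in>I. if i = j then c j else 0)"
      using that by (intro sum.cong) (auto simp: dual)
    finally show ?thesis using that fin by simp
  qed
  show ind: "independent (e ` I)"
  proof (rule independent_if_scalars_zero)
    show "finite (e ` I)" using fin by simp
    fix f x assume z: "(\<Sum>x\<in>e ` I. f x *\<^sub>R x) = 0" and "x \<in> e ` I"
    then obtain i where i: "i \<in> I" "x = e i" by blast
    have "(\<Sum>j\<in>I. f (e j) *\<^sub>R e j) = 0"
      using z by (simp add: sum.reindex[OF inj])
    then show "f x = 0" using coord[OF i(1), of "\<lambda>j. f (e j)"] lin[OF i(1)] i
      by (simp add: linear_0)
  qed
  have rep: "\<exists>c. x = (\<Sum>j\<in>I. c j *\<^sub>R e j) \<and> (\<forall>j\<in>I. c j = representation (e ` I) x (e j))"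
    if "x \<in> span (e ` I)" for x
    using sum_representation_eq[OF ind that, of "e ` I"] fin
    by (intro exI[of _ "\<lambda>j. representation (e ` I) x (e j)"]) (auto simp: sum.reindex[OF inj])
  show "(\<Sum>i\<in>I. \<phi> i x *\<^sub>R e i) = x" if "x \<in> span (e ` I)" for x
  proof -
    obtain c where c: "x = (\<Sum>j\<in>I. c j *\<^sub>R e j)" using rep[OF \<open>x \<in> _\<close>] by blast
    then have "\<And>i. i \<in> I \<Longrightarrow> \<phi> i x = c i" using coord by blast
    then show ?thesis using c by simp
  qed
  show "representation (e ` I) x (e i) = \<phi> i x" if "x \<in> span (e ` I)" "i \<in> I" for x i
    using rep[OF that(1)] coord[OF that(2)] that(2) by metis
qed

lemma dual_family_exists:
  fixes e :: "'i \<Rightarrow> 'a::real_vector"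
  assumes "inj_on e I" "independent (e ` I)"
  shows "\<exists>\<phi>. (\<forall>i. linear (\<phi> i)) \<and>
    (\<forall>i\<in>I. \<forall>j\<in>I. \<phi> i (e j) = (if i = j then 1 else (0::real)))"
proof -
  have "\<forall>i. \<exists>g. linear g \<and> (\<forall>x\<in>e ` I. g x = (if x = e i then 1 else (0::real)))"
    by (intro allI linear_independent_extend[OF assms(2)])
  from choice[OF this] obtain \<phi> where \<phi>: "\<And>i. linear (\<phi> i)"
    "\<And>i x. x \<in> e ` I \<Longrightarrow> \<phi> i x = (if x = e i then 1 else (0::real))" by blast
  have "\<phi> i (e j) = (if i = j then 1 else 0)" if "i \<in> I" "j \<in> I" for i j
    using \<phi>(2)[OF imageI[OF that(2)], of i] inj_on_eq_iff[OF assms(1) that(2,1)] by auto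
  then show ?thesis using \<phi>(1) by (intro exI[of _ \<phi>] conjI allI ballI) simp_all
qed

text \<open>Since \<open>trace_on\<close> is evaluated in a basis picked by choice, any use of it needs independence of the
  basis. Expanding the images of one basis in the other and exchanging the sums is the identity
  \<open>Tr (P Q) = Tr (Q P)\<close> for the two change-of-basis matrices.\<close>

lemma trace_on_basis:
  fixes f :: "'a::real_vector \<Rightarrow> 'a"
  assumes C: "independent C" "span C = V" "finite C"
    and f: "linear f" "\<And>v. v \<in> V \<Longrightarrow> f v \<in> V"
  shows "trace_on V f = (\<Sum>c\<in>C. representation C (f c) c)"
proof -
  define B where "B = (SOME B. independent B \<and> span B = V)"
  have B: "independent B" "span B = V"
    using someI[of "\<lambda>B. independent B \<and> span B = V" C] C unfolding B_def by blast+
  have finB: "finite B"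
    using independent_span_bound[OF C(3) B(1)] B(2) C(2) span_superset by blast
  have change: "representation P v p = (\<Sum>q\<in>Q. representation Q v q * representation P q p)"
    if "v \<in> V" "independent P" "span P = V" "independent Q" "span Q = V" "finite Q" for P Q v p
  proof -
    have "v = (\<Sum>q\<in>Q. representation Q v q *\<^sub>R q)"
      using sum_representation_eq[of Q v Q] that by simp
    then have "representation P v p = representation P (\<Sum>q\<in>Q. representation Q v q *\<^sub>R q) p"
      by simp
    also have "\<dots> = (\<Sum>q\<in>Q. representation P (representation Q v q *\<^sub>R q) p)"
      using that by (subst representation_sum) (auto intro: span_scale span_base)
    also have "\<dots> = (\<Sum>q\<in>Q. representation Q v q * representation P q p)"
    proof (intro sum.cong refl)
      fix q assume "q \<in> Q"
      then have "q \<in> span P" using that span_base by blast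
      then show "representation P (representation Q v q *\<^sub>R q) p
          = representation Q v q * representation P q p"
        using that by (simp add: representation_scale)
    qed
    finally show ?thesis .
  qed
  have inV: "b \<in> V" if "b \<in> B \<or> b \<in> C" for b using that B C span_base by blast
  have "trace_on V f = (\<Sum>b\<in>B. representation B (f b) b)"
    unfolding trace_on_def B_def[symmetric] Let_def by simp
  also have "\<dots> = (\<Sum>b\<in>B. \<Sum>c\<in>C. representation C (f b) c * representation B c b)"
    using inV f B C by (intro sum.cong change) auto
  also have "\<dots> = (\<Sum>c\<in>C. \<Sum>b\<in>B. representation B c b * representation C (f b) c)"
    by (subst sum.swap) (simp add: mult.commute)
  also have "\<dots> = (\<Sum>c\<in>C. representation C (f c) c)"
  proof (intro sum.cong refl)
    fix c assume c: "c \<in> C"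
    have "f c = f (\<Sum>b\<in>B. representation B c b *\<^sub>R b)"
      using sum_representation_eq[of B c B] B finB inV c by simp
    also have "\<dots> = (\<Sum>b\<in>B. representation B c b *\<^sub>R f b)"
      using f(1) by (simp add: linear_sum linear_scale)
    finally have "representation C (f c) c = representation C (\<Sum>b\<in>B. representation B c b *\<^sub>R f b) c"
      by simp
    also have "\<dots> = (\<Sum>b\<in>B. representation C (representation B c b *\<^sub>R f b) c)"
      using inV f C by (subst representation_sum) (auto intro: span_scale)
    also have "\<dots> = (\<Sum>b\<in>B. representation B c b * representation C (f b) c)"
      using inV f C by (intro sum.cong) (auto simp: representation_scale)
    finally show "(\<Sum>b\<in>B. representation B c b * representation C (f b) c) = representation C (f c) c" ..
  qed
  finally show ?thesis .
qed

lemma trace_on_dual_family: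
  fixes e :: "'i \<Rightarrow> 'a::real_vector"
  assumes fin: "finite I"
    and lin: "\<And>i. i \<in> I \<Longrightarrow> linear (\<phi> i)"
    and dual: "\<And>i j. i \<in> I \<Longrightarrow> j \<in> I \<Longrightarrow> \<phi> i (e j) = (if i = j then 1 else (0::real))"
    and f: "linear f" "\<And>v. v \<in> span (e ` I) \<Longrightarrow> f v \<in> span (e ` I)"
  shows "trace_on (span (e ` I)) f = (\<Sum>i\<in>I. \<phi> i (f (e i)))"
proof -
  note D = dual_family_representation[of I \<phi> e, OF fin lin dual]
  have "trace_on (span (e ` I)) f = (\<Sum>c\<in>e ` I. representation (e ` I) (f c) c)"
    using fin f D by (intro trace_on_basis) auto
  also have "\<dots> = (\<Sum>i\<in>I. representation (e ` I) (f (e i)) (e i))"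
    using D(1) by (simp add: sum.reindex)
  also have "\<dots> = (\<Sum>i\<in>I. \<phi> i (f (e i)))"
    by (intro sum.cong refl D(4) f(2) span_base imageI)
  finally show ?thesis .
qed

text \<open>A basis of the kernel of \<open>\<tau>\<close> that extends the \<open>X i\<close>, completed by \<open>Y\<close>. With \<open>\<tau>\<close> the trace of the adjoint
  representation and this basis made orthogonal, the mean curvature vector is a multiple of \<open>Y\<close>.\<close>

lemma basis_adapted_to_functional:
  fixes X :: "nat \<Rightarrow> 'a::real_vector" and \<tau> :: "'a \<Rightarrow> real"
  assumes fd: "\<exists>B :: 'a set. finite B \<and> span B = UNIV"
    and X: "inj_on X {1..l}" "independent (X ` {1..l})"
    and \<tau>: "linear \<tau>" "\<And>i. i \<in> {1..l} \<Longrightarrow> \<tau> (X i) = 0" "\<tau> Y = 1"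
  shows "\<exists>n e. l < n \<and> inj_on e {1..n} \<and> independent (e ` {1..n}) \<and> span (e ` {1..n}) = UNIV \<and>
    (\<forall>i\<in>{1..l}. e i = X i) \<and> e n = Y \<and> (\<forall>h\<in>{Suc l..n}. \<tau> (e h) = (if h = n then 1 else 0))"
proof -
  define V where "V = {v. \<tau> v = 0}"
  have subV: "subspace V" unfolding V_def by (rule linear_subspace_kernel[OF \<tau>(1)])
  have XV: "X ` {1..l} \<subseteq> V" using \<tau>(2) by (auto simp: V_def)
  obtain B where B: "X ` {1..l} \<subseteq> B" "B \<subseteq> V" "independent B" "V \<subseteq> span B"
    using maximal_independent_subset_extend[OF XV X(2)] by blast
  have spB: "span B = V" using B span_minimal[OF B(2) subV] by blast
  have "Y \<notin> span B" unfolding spB using \<tau>(3) by (simp add: V_def)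
  then have ind: "independent (insert Y B)" and YB: "Y \<notin> B"
    using B(3) independent_insertI span_base[of Y B] by blast+
  obtain T :: "'a set" where T: "finite T" "span T = UNIV" using fd by blast
  have finB: "finite B" using independent_span_bound[OF T(1) B(3)] T(2) by simp
  define C where "C = B - X ` {1..l}"
  have finC: "finite C" using finB by (simp add: C_def)
  obtain g where g: "bij_betw g {0..<card C} C" using ex_bij_betw_nat_finite[OF finC] by blast
  define n where "n = Suc (l + card C)"
  define e where "e i = (if i \<le> l then X i else if i < n then g (i - Suc l) else Y)" for i
  have eX: "e i = X i" if "i \<in> {1..l}" for i using that by (simp add: e_def)
  have en: "e n = Y" by (simp add: e_def n_def)
  have shift: "bij_betw (\<lambda>i. i - Suc l) {Suc l..<n} {0..<card C}"
    by (rule bij_betw_byWitness[where f' = "\<lambda>i. i + Suc l"]) (auto simp: n_def)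
  have eC: "bij_betw e {Suc l..<n} C"
  proof -
    have "bij_betw (g \<circ> (\<lambda>i. i - Suc l)) {Suc l..<n} C" by (rule bij_betw_trans[OF shift g])
    then show ?thesis by (rule bij_betw_cong[THEN iffD1, rotated]) (auto simp: e_def)
  qed
  have eX': "bij_betw e {1..l} (X ` {1..l})"
    using inj_on_imp_bij_betw[OF X(1)] by (rule bij_betw_cong[THEN iffD2, rotated]) (rule eX)
  have "bij_betw e ({1..l} \<union> {Suc l..<n}) (X ` {1..l} \<union> C)"
    by (rule bij_betw_combine[OF eX' eC]) (auto simp: C_def)
  moreover have "bij_betw e {n} {Y}" using en by (simp add: bij_betw_def)
  moreover have "X ` {1..l} \<union> C = B" using B(1) by (auto simp: C_def)
  ultimately have "bij_betw e ({1..l} \<union> {Suc l..<n} \<union> {n}) (B \<union> {Y})"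
    using YB by (intro bij_betw_combine) auto
  moreover have "{1..l} \<union> {Suc l..<n} \<union> {n} = {1..n}" by (auto simp: n_def)
  ultimately have eI: "bij_betw e {1..n} (insert Y B)" by simp
  have sp: "span (insert Y B) = UNIV"
  proof -
    have "v \<in> span (insert Y B)" for v
    proof -
      have "\<tau> (v - \<tau> v *\<^sub>R Y) = 0" using \<tau> by (simp add: linear_diff linear_scale)
      then have "v - \<tau> v *\<^sub>R Y \<in> span B" unfolding spB V_def by simp
      then show ?thesis unfolding span_insert by blast
    qed
    then show ?thesis by blast
  qed
  have "\<tau> (e h) = (if h = n then 1 else 0)" if "h \<in> {Suc l..n}" for h
  proof (cases "h = n")
    case False
    then have "e h \<in> C" using that bij_betwE[OF eC] by simp
    then have "e h \<in> V" using B(2) by (auto simp: C_def)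
    then show ?thesis using False by (simp add: V_def)
  qed (use en \<tau>(3) in simp)
  then have "l < n \<and> inj_on e {1..n} \<and> independent (e ` {1..n}) \<and> span (e ` {1..n}) = UNIV \<and>
    (\<forall>i\<in>{1..l}. e i = X i) \<and> e n = Y \<and> (\<forall>h\<in>{Suc l..n}. \<tau> (e h) = (if h = n then 1 else 0))"
    using eI ind sp eX en unfolding bij_betw_def by (auto simp: n_def)
  then show ?thesis by blast
qed

section \<open>Orthonormal bases of an abstract inner product\<close>

lemma bilinear_sum_scale:
  fixes h :: "'a::real_vector \<Rightarrow> 'b::real_vector \<Rightarrow> 'c::real_vector"
  assumes "bilinear h"
  shows bilinear_sum_scale_left: "h (\<Sum>i\<in>I. c i *\<^sub>R u i) y = (\<Sum>i\<in>I. c i *\<^sub>R h (u i) y)"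
    and bilinear_sum_scale_right: "h x (\<Sum>i\<in>I. c i *\<^sub>R v i) = (\<Sum>i\<in>I. c i *\<^sub>R h x (v i))"
proof -
  have lin: "linear (h x)" "linear (\<lambda>u. h u y)" for x y
    using assms by (auto simp: bilinear_def)
  show "h (\<Sum>i\<in>I. c i *\<^sub>R u i) y = (\<Sum>i\<in>I. c i *\<^sub>R h (u i) y)"
    by (simp add: linear_sum[OF lin(2)[of y]] linear_scale[OF lin(2)[of y]])
  show "h x (\<Sum>i\<in>I. c i *\<^sub>R v i) = (\<Sum>i\<in>I. c i *\<^sub>R h x (v i))"
    by (simp add: linear_sum[OF lin(1)] linear_scale[OF lin(1)])
qed

lemma inner_product_bilinear: "inner_product ip \<Longrightarrow> bilinear ip"
  and inner_product_sym: "inner_product ip \<Longrightarrow> ip x y = ip y x"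
  and inner_product_pos: "inner_product ip \<Longrightarrow> x \<noteq> 0 \<Longrightarrow> ip x x > 0"
  unfolding inner_product_def by auto

lemma inner_product_linear:
  assumes "inner_product ip"
  shows inner_product_linear_right: "linear (ip x)"
    and inner_product_linear_left: "linear (\<lambda>y. ip y x)"
  using inner_product_bilinear[OF assms] by (auto simp: bilinear_def)

lemma inner_product_eqI:
  assumes ip: "inner_product ip" and eq: "\<And>z. ip x z = ip y z"
  shows "x = y"
proof (rule ccontr)
  assume "x \<noteq> y"
  then have "ip (x - y) (x - y) > 0" using inner_product_pos[OF ip] by simp
  then show False using eq[of "x - y"] inner_product_bilinear[OF ip]
    by (simp add: bilinear_lsub)
qed

definition orthonormal :: "('a::real_vector \<Rightarrow> 'a \<Rightarrow> real) \<Rightarrow> 'a set \<Rightarrow> bool" where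
  "orthonormal ip E \<longleftrightarrow> (\<forall>u\<in>E. \<forall>v\<in>E. ip u v = (if u = v then 1 else 0))"

lemma orthonormal_basis_iff: "orthonormal_basis ip E \<longleftrightarrow> orthonormal ip E \<and> span E = UNIV"
  unfolding orthonormal_basis_def orthonormal_def by auto

lemma orthonormal_dual:
  assumes ip: "inner_product ip" and E: "orthonormal ip E" "finite E"
  shows orthonormal_independent: "independent E"
    and orthonormal_expansion: "x \<in> span E \<Longrightarrow> (\<Sum>e\<in>E. ip x e *\<^sub>R e) = x"
    and orthonormal_trace: "linear f \<Longrightarrow> (\<And>v. v \<in> span E \<Longrightarrow> f v \<in> span E) \<Longrightarrow>
      trace_on (span E) f = (\<Sum>e\<in>E. ip (f e) e)"
proof -
  have lin: "linear (\<lambda>y. ip y e)" for e using inner_product_linear_left[OF ip] .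
  have dual: "ip v u = (if u = v then 1 else 0)" if "u \<in> E" "v \<in> E" for u v
    using E(1) that unfolding orthonormal_def by metis
  note D = dual_family_representation[of E "\<lambda>e y. ip y e" "\<lambda>e. e", OF E(2) lin dual]
  show "independent E" using D(2) by simp
  show "x \<in> span E \<Longrightarrow> (\<Sum>e\<in>E. ip x e *\<^sub>R e) = x" using D(3) by simp
  show "linear f \<Longrightarrow> (\<And>v. v \<in> span E \<Longrightarrow> f v \<in> span E) \<Longrightarrow>
      trace_on (span E) f = (\<Sum>e\<in>E. ip (f e) e)"
    using trace_on_dual_family[of E "\<lambda>e y. ip y e" "\<lambda>e. e" f, OF E(2) lin dual] by simp
qed

lemma orthonormal_parseval:
  assumes ip: "inner_product ip" and E: "orthonormal ip E" "finite E" and x: "x \<in> span E"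
  shows "ip x y = (\<Sum>e\<in>E. ip x e * ip y e)"
proof -
  have "ip x y = ip (\<Sum>e\<in>E. ip x e *\<^sub>R e) y"
    using orthonormal_expansion[OF ip E x] by simp
  also have "\<dots> = (\<Sum>e\<in>E. ip x e * ip e y)"
    by (simp add: bilinear_sum_scale_left[OF inner_product_bilinear[OF ip]])
  finally show ?thesis using inner_product_sym[OF ip] by simp
qed

text \<open>Gram--Schmidt for an inner product given as a function and not as a type class instance.\<close>

lemma orthonormal_extend:
  assumes ip: "inner_product ip" and "finite B" and E0: "finite E0" "orthonormal ip E0"
  shows "\<exists>E. finite E \<and> E0 \<subseteq> E \<and> orthonormal ip E \<and> span E = span (E0 \<union> B)"
  using \<open>finite B\<close>
proof induction
  case empty
  then show ?case using E0 by auto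
next
  case (insert x B)
  then obtain E where E: "finite E" "E0 \<subseteq> E" "orthonormal ip E" "span E = span (E0 \<union> B)" by blast
  define y where "y = x - (\<Sum>e\<in>E. ip x e *\<^sub>R e)"
  have inE: "(\<Sum>e\<in>E. ip x e *\<^sub>R e) \<in> span E"
    by (intro span_sum span_scale span_base)
  then have inEw: "(\<Sum>e\<in>E. ip x e *\<^sub>R e) \<in> span (insert w E)" for w
    using span_mono[OF subset_insertI] by blast
  have spx: "span (E0 \<union> insert x B) = span (insert x E)"
  proof -
    have "span (E0 \<union> insert x B) = span (insert x (E0 \<union> B))" by simp
    also have "\<dots> = span (insert x E)"
      unfolding span_insert using E(4) by simp
    finally show ?thesis .
  qed
  show ?case
  proof (cases "y = 0")
    case True
    then have "x \<in> span E" using inE by (simp add: y_def)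
    then show ?thesis using E spx by (metis span_redundant)
  next
    case False
    have ort: "ip y e = 0" if "e \<in> E" for e
    proof -
      have "ip y e = ip x e - (\<Sum>f\<in>E. ip x f * ip f e)"
        unfolding y_def 
        by (simp add: bilinear_lsub[OF inner_product_bilinear[OF ip]]
            bilinear_sum_scale_left[OF inner_product_bilinear[OF ip]])
      also have "(\<Sum>f\<in>E. ip x f * ip f e) = (\<Sum>f\<in>E. if f = e then ip x f else 0)"
        using E(3) that by (intro sum.cong) (auto simp: orthonormal_def)
      finally show ?thesis using E(1) that by simp
    qed
    define z where "z = (1 / sqrt (ip y y)) *\<^sub>R y"
    have yy: "ip y y > 0" using inner_product_pos[OF ip False] .
    have b: "bilinear ip" using inner_product_bilinear[OF ip] .
    have zz: "ip z z = 1"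
      using yy by (simp add: z_def bilinear_lmul[OF b] bilinear_rmul[OF b] field_simps)
    have ze: "ip z e = 0" "ip e z = 0" if "e \<in> E" for e
      using ort[OF that] inner_product_sym[OF ip] by (auto simp: z_def bilinear_lmul[OF b] bilinear_rmul[OF b])
    have on: "orthonormal ip (insert z E)"
      using E(3) ze zz unfolding orthonormal_def by (auto; metis zero_neq_one)
    have "span (insert z E) = span (insert x E)"
    proof (rule span_eq[THEN iffD2], intro conjI insert_subsetI)
      have "y \<in> span (insert x E)"
        unfolding y_def by (intro span_diff inEw) (simp add: span_base)
      then show "z \<in> span (insert x E)" unfolding z_def by (rule span_scale)
      have "x = sqrt (ip y y) *\<^sub>R z + (\<Sum>e\<in>E. ip x e *\<^sub>R e)"
        using yy by (simp add: z_def y_def)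
      moreover have "\<dots> \<in> span (insert z E)"
        by (intro span_add span_scale inEw) (simp add: span_base)
      ultimately show "x \<in> span (insert z E)" by simp
    qed (auto intro: span_base)
    then show ?thesis using E on spx by (intro exI[of _ "insert z E"]) auto
  qed
qed

lemma bilinear_real_multI:
  fixes f g :: "'a::real_vector \<Rightarrow> real"
  assumes "linear f" "linear g"
  shows "bilinear (\<lambda>u v. f u * g v)"
  using assms unfolding bilinear_def
  by (auto intro!: linearI simp: linear_add linear_scale algebra_simps)

text \<open>The sum is the trace of \<open>\<phi>\<close> with respect to the inner product; expanding one copy of each basis
  vector in the other basis turns either side into the same double sum.\<close>

lemma orthonormal_basis_sum_invariant:
  fixes \<phi> :: "'a::real_vector \<Rightarrow> 'a \<Rightarrow> real"
  assumes ip: "inner_product ip" and \<phi>: "bilinear \<phi>"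
    and E: "orthonormal_basis ip E" "finite E" and F: "orthonormal_basis ip F" "finite F"
  shows "(\<Sum>e\<in>E. \<phi> e e) = (\<Sum>f\<in>F. \<phi> f f)"
proof -
  have exE: "(\<Sum>e\<in>E. ip x e *\<^sub>R e) = x" and exF: "(\<Sum>e\<in>F. ip x e *\<^sub>R e) = x" for x
    using orthonormal_expansion[OF ip] E F by (auto simp: orthonormal_basis_iff)
  have "(\<Sum>e\<in>E. \<phi> e e) = (\<Sum>e\<in>E. \<phi> (\<Sum>f\<in>F. ip e f *\<^sub>R f) e)" by (simp add: exF)
  also have "\<dots> = (\<Sum>e\<in>E. \<Sum>f\<in>F. ip e f * \<phi> f e)"
    by (simp add: bilinear_sum_scale_left[OF \<phi>])
  also have "\<dots> = (\<Sum>f\<in>F. \<Sum>e\<in>E. ip f e * \<phi> f e)"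
    by (subst sum.swap) (simp add: inner_product_sym[OF ip])
  also have "\<dots> = (\<Sum>f\<in>F. \<phi> f (\<Sum>e\<in>E. ip f e *\<^sub>R e))"
    by (simp add: bilinear_sum_scale_right[OF \<phi>])
  finally show ?thesis by (simp add: exE)
qed

section \<open>The Ricci form in an orthonormal basis\<close>

lemma trace_vector_eq:
  fixes br :: "'a::real_vector \<Rightarrow> 'a \<Rightarrow> 'a"
  assumes br: "bilinear br" and ip: "inner_product ip"
    and E: "orthonormal_basis ip E" "finite E"
  shows "trace_vector br ip = (\<Sum>e\<in>E. (\<Sum>f\<in>E. ip (br e f) f) *\<^sub>R e)" (is "_ = ?H")
proof -
  have E': "orthonormal ip E" "span E = UNIV" using E by (auto simp: orthonormal_basis_iff)
  have linb: "linear (br x)" "linear (\<lambda>x. br x y)" for x y using br by (auto simp: bilinear_def)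
  have tr: "trace_on UNIV (br x) = (\<Sum>f\<in>E. ip (br x f) f)" for x
    using orthonormal_trace[OF ip E'(1) E(2) linb(1)] E'(2) by simp
  have lin1: "linear (\<lambda>x. ip (br x f) f)" for f
    using linear_compose[OF linb(2)[of f] inner_product_linear_left[OF ip, of f]] by (simp add: o_def)
  have lin: "linear (\<lambda>x. \<Sum>f\<in>E. ip (br x f) f)"
    by (rule linear_compose_sum) (use lin1 in blast)
  have H: "ip ?H x = trace_on UNIV (br x)" for x
  proof -
    have "ip ?H x = (\<Sum>e\<in>E. (\<Sum>f\<in>E. ip (br e f) f) * ip e x)"
      by (simp add: bilinear_sum_scale_left[OF inner_product_bilinear[OF ip]])
    also have "\<dots> = (\<Sum>e\<in>E. ip x e * (\<Sum>f\<in>E. ip (br e f) f))"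
      by (simp add: inner_product_sym[OF ip] mult.commute)
    also have "\<dots> = (\<Sum>f\<in>E. ip (br (\<Sum>e\<in>E. ip x e *\<^sub>R e) f) f)"
      by (simp only: linear_sum[OF lin] linear_scale[OF lin] real_scaleR_def)
    also have "\<dots> = trace_on UNIV (br x)"
      using orthonormal_expansion[OF ip E'(1) E(2)] E'(2) by (simp add: tr)
    finally show ?thesis .
  qed
  show ?thesis unfolding trace_vector_def
    by (rule the_equality) (use H inner_product_eqI[OF ip] in auto)
qed

text \<open>The definition of \<open>ricci\<close> picks an orthonormal basis by choice. Each sum in it is a trace of a
  bilinear form (the double sum in each of its two variables separately), so any orthonormal basis may be used.\<close>

lemma ricci_orthonormal_basis:
  fixes br :: "'a::real_vector \<Rightarrow> 'a \<Rightarrow> 'a"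
  assumes br: "bilinear br" and ip: "inner_product ip"
    and E: "orthonormal_basis ip E" "finite E"
  shows "ricci br ip x = - ip (br (trace_vector br ip) x) x
     - 1/2 * (\<Sum>e\<in>E. ip (br x (br x e)) e) - 1/2 * (\<Sum>e\<in>E. ip (br x e) (br x e))
     + 1/4 * (\<Sum>e\<in>E. \<Sum>f\<in>E. (ip (br e f) x)\<^sup>2)"
proof -
  define F where "F = (SOME F. orthonormal_basis ip F)"
  have F: "orthonormal_basis ip F" unfolding F_def using E(1) by (rule someI)
  have E': "orthonormal ip E" "span E = UNIV" using E by (auto simp: orthonormal_basis_iff)
  have F': "orthonormal ip F" "span F = UNIV" using F by (auto simp: orthonormal_basis_iff)
  have indF: "independent F"
  proof (subst independent_explicit_finite_subsets, intro allI impI ballI)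
    fix A u v assume A: "A \<subseteq> F" "finite A" "(\<Sum>v\<in>A. u v *\<^sub>R v) = 0" "v \<in> A"
    have "independent A"
      using orthonormal_independent[OF ip _ A(2)] F'(1) A(1) by (auto simp: orthonormal_def)
    then show "u v = 0" using A independent_explicit_finite_subsets by blast
  qed
  have finF: "finite F" using independent_span_bound[OF E(2) indF] E'(2) by simp
  note lin = inner_product_linear_left[OF ip]
  have linb: "linear (br x)" "linear (\<lambda>x. br x y)" for x y using br by (auto simp: bilinear_def)
  have kill: "killing_form br x x = (\<Sum>e\<in>E. ip (br x (br x e)) e)"
    unfolding killing_form_def
    using orthonormal_trace[OF ip E'(1) E(2), of "\<lambda>z. br x (br x z)"] E'(2)
      linear_compose[OF linb(1)[of x] linb(1)[of x]] by (simp add: o_def)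
  have "bilinear (\<lambda>u v. ip (br x u) (br x v))"
    unfolding bilinear_def
    using linear_compose[OF linb(1) inner_product_linear_right[OF ip]]
      linear_compose[OF linb(1) inner_product_linear_left[OF ip]] by (auto simp: o_def)
  then have s1: "(\<Sum>e\<in>F. ip (br x e) (br x e)) = (\<Sum>e\<in>E. ip (br x e) (br x e))"
    using orthonormal_basis_sum_invariant[OF ip _ F finF E] by blast
  have l1: "linear (\<lambda>u. ip (br e u) x)" "linear (\<lambda>u. ip (br u e) x)" for e
    using linear_compose[OF linb(1) lin] linear_compose[OF linb(2) lin] by (auto simp: o_def)
  have "(\<Sum>e\<in>F. \<Sum>f\<in>F. (ip (br e f) x)\<^sup>2) = (\<Sum>e\<in>F. \<Sum>f\<in>E. (ip (br e f) x)\<^sup>2)"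
    unfolding power2_eq_square
    by (intro sum.cong refl
      orthonormal_basis_sum_invariant[OF ip bilinear_real_multI[OF l1(1) l1(1)] F finF E])
  also have "\<dots> = (\<Sum>f\<in>E. \<Sum>e\<in>F. (ip (br e f) x)\<^sup>2)" by (rule sum.swap)
  also have "\<dots> = (\<Sum>f\<in>E. \<Sum>e\<in>E. (ip (br e f) x)\<^sup>2)"
    unfolding power2_eq_square
    by (intro sum.cong refl
      orthonormal_basis_sum_invariant[OF ip bilinear_real_multI[OF l1(2) l1(2)] F finF E])
  also have "\<dots> = (\<Sum>e\<in>E. \<Sum>f\<in>E. (ip (br e f) x)\<^sup>2)" by (rule sum.swap)
  finally have s2: "(\<Sum>e\<in>F. \<Sum>f\<in>F. (ip (br e f) x)\<^sup>2) = (\<Sum>e\<in>E. \<Sum>f\<in>E. (ip (br e f) x)\<^sup>2)" .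
  show ?thesis
    unfolding ricci_def Let_def F_def[symmetric] kill s1 s2 ..
qed

section \<open>Abelian ideals and negative Ricci curvature\<close>

lemma lie_bracket_skew:
  assumes "lie_bracket br"
  shows "br x y = - br y x"
proof -
  have bil: "bilinear br" and alt: "\<And>x. br x x = 0"
    using assms by (auto simp: lie_bracket_def)
  have "0 = br (x + y) (x + y)" by (rule alt[symmetric])
  also have "\<dots> = br x y + br y x"
    unfolding bilinear_ladd[OF bil] bilinear_radd[OF bil] by (simp add: alt)
  finally show ?thesis by (simp add: eq_neg_iff_add_eq_0)
qed

text \<open>The trace of the Ricci form over an abelian ideal \<open>A\<close> is at least \<open>- Tr (ad H | A)\<close>. In the proof
  \<open>S\<close> is the sum of the squared norms of \<open>[f, e]\<close> with \<open>e\<close> in the basis of \<open>A\<close> and \<open>f\<close> in the rest: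
  it enters once with factor \<open>- 1/2\<close>, and twice with factor \<open>1/4\<close>, because the ordered pairs
  \<open>(e, f)\<close> and \<open>(f, e)\<close> both contribute to the last term.\<close>

lemma negative_ricci_abelian_ideal:
  fixes br :: "'a::real_vector \<Rightarrow> 'a \<Rightarrow> 'a"
  assumes fin: "finite B" "span B = (UNIV :: 'a set)"
    and br: "lie_bracket br" and ip: "inner_product ip" and neg: "negative_ricci br ip"
    and A: "lie_ideal br A" "A \<noteq> {0}" "\<And>x y. x \<in> A \<Longrightarrow> y \<in> A \<Longrightarrow> br x y = 0"
  shows "trace_on A (br (trace_vector br ip)) > 0"
proof -
  define H where "H = trace_vector br ip"
  have bil: "bilinear br" and alt: "br x x = 0" for x
    using br by (auto simp: lie_bracket_def)
  note anti = lie_bracket_skew[OF br]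
  have sub: "subspace A" and ideal_right: "\<And>x y. y \<in> A \<Longrightarrow> br x y \<in> A"
    using A(1) by (auto simp: lie_ideal_def)
  have ideal_left: "br x y \<in> A" if "x \<in> A" for x y
    using anti[of x y] ideal_right[OF that, of y] subspace_neg[OF sub] by simp
  note ideal = ideal_right ideal_left
  obtain C where C: "C \<subseteq> A" "independent C" "A \<subseteq> span C"
    using maximal_independent_subset by blast
  have spC: "span C = A" using C span_minimal[OF C(1) sub] by blast
  have finC: "finite C" using independent_span_bound[OF fin(1) C(2)] fin(2) by simp
  obtain E1 where E1: "finite E1" "orthonormal ip E1" "span E1 = A"
    using orthonormal_extend[OF ip finC, of "{}"] spC by (auto simp: orthonormal_def)
  obtain E where E: "finite E" "E1 \<subseteq> E" "orthonormal ip E" "span E = span (E1 \<union> B)"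
    using orthonormal_extend[OF ip fin(1) E1(1,2)] by blast
  have "span B \<subseteq> span (E1 \<union> B)" by (intro span_mono) auto
  then have onb: "orthonormal_basis ip E" using E fin(2) by (auto simp: orthonormal_basis_iff)
  define E2 where "E2 = E - E1"
  have E2: "finite E2" "E1 \<inter> E2 = {}" "E = E1 \<union> E2" using E by (auto simp: E2_def)
  have inA: "e \<in> A" if "e \<in> E1" for e using that E1(3) span_base by blast
  have pos: "ip x x \<ge> 0" for x
    using inner_product_pos[OF ip, of x] bilinear_lzero[OF inner_product_bilinear[OF ip]]
    by (cases "x = 0") auto
  have parse: "ip x x = (\<Sum>e\<in>E1. (ip x e)\<^sup>2)" if "x \<in> A" for x
    using orthonormal_parseval[OF ip E1(2,1), of x x] that E1(3) by (simp add: power2_eq_square)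
  define S where "S = (\<Sum>f\<in>E2. \<Sum>e\<in>E1. ip (br f e) (br f e))"
  have ric: "ricci br ip e = - ip (br H e) e - 1/2 * (\<Sum>f\<in>E2. ip (br e f) (br e f))
       + 1/4 * (\<Sum>f\<in>E. \<Sum>g\<in>E. (ip (br f g) e)\<^sup>2)" if e: "e \<in> E1" for e
  proof -
    have "br e (br e f) = 0" for f using A(3) inA[OF e] ideal(2) by blast
    then have 1: "(\<Sum>f\<in>E. ip (br e (br e f)) f) = 0"
      by (simp add: bilinear_lzero[OF inner_product_bilinear[OF ip]])
    have "(\<Sum>f\<in>E1. ip (br e f) (br e f)) = 0"
      using A(3) inA e by (simp add: bilinear_lzero[OF inner_product_bilinear[OF ip]])
    then have 2: "(\<Sum>f\<in>E. ip (br e f) (br e f)) = (\<Sum>f\<in>E2. ip (br e f) (br e f))"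
      using E2 E1(1) by (simp add: sum.union_disjoint)
    show ?thesis
      unfolding ricci_orthonormal_basis[OF bil ip onb E(1)] 1 2 H_def by simp
  qed
  \<comment> \<open>only the pairs with exactly one vector in \<open>A\<close> are kept; since \<open>[f, e]\<close> lies in \<open>A\<close>, Parseval
    recovers its full squared norm from the components along the basis of \<open>A\<close>\<close>
  have half: "2 * S \<le> (\<Sum>e\<in>E1. \<Sum>f\<in>E. \<Sum>g\<in>E. (ip (br f g) e)\<^sup>2)"
  proof -
    have "(\<Sum>e\<in>E1. \<Sum>f\<in>E. \<Sum>g\<in>E. (ip (br f g) e)\<^sup>2)
        = (\<Sum>f\<in>E. \<Sum>g\<in>E. \<Sum>e\<in>E1. (ip (br f g) e)\<^sup>2)"
      by (subst sum.swap, rule sum.cong[OF refl], rule sum.swap)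
    also have "\<dots> \<ge> (\<Sum>f\<in>E2. \<Sum>g\<in>E1. \<Sum>e\<in>E1. (ip (br f g) e)\<^sup>2)
        + (\<Sum>f\<in>E1. \<Sum>g\<in>E2. \<Sum>e\<in>E1. (ip (br f g) e)\<^sup>2)"
      unfolding E2(3) sum.union_disjoint[OF E1(1) E2(1,2)] sum.distrib
      by (smt (verit) sum_nonneg zero_le_power2)
    moreover have "(\<Sum>f\<in>E2. \<Sum>g\<in>E1. \<Sum>e\<in>E1. (ip (br f g) e)\<^sup>2) = S"
      unfolding S_def using parse ideal(1) inA by (intro sum.cong) auto
    moreover have "(\<Sum>f\<in>E1. \<Sum>g\<in>E2. \<Sum>e\<in>E1. (ip (br f g) e)\<^sup>2) = S"
    proof -
      have "(\<Sum>f\<in>E1. \<Sum>g\<in>E2. \<Sum>e\<in>E1. (ip (br f g) e)\<^sup>2)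
          = (\<Sum>g\<in>E2. \<Sum>f\<in>E1. \<Sum>e\<in>E1. (ip (br f g) e)\<^sup>2)" by (rule sum.swap)
      also have "\<dots> = (\<Sum>g\<in>E2. \<Sum>f\<in>E1. ip (br f g) (br f g))"
        using parse ideal(2) inA by (intro sum.cong) auto
      also have "\<dots> = S"
        unfolding S_def
        by (intro sum.cong refl, subst (1 2) anti)
          (simp add: bilinear_lneg[OF inner_product_bilinear[OF ip]]
            bilinear_rneg[OF inner_product_bilinear[OF ip]])
      finally show ?thesis .
    qed
    ultimately show ?thesis by linarith
  qed
  have SS: "(\<Sum>e\<in>E1. \<Sum>f\<in>E2. ip (br e f) (br e f)) = S"
    unfolding S_def
    by (subst sum.swap, intro sum.cong refl, subst (1 2) anti)
      (simp add: bilinear_lneg[OF inner_product_bilinear[OF ip]]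
        bilinear_rneg[OF inner_product_bilinear[OF ip]])
  have tr: "trace_on A (br H) = (\<Sum>e\<in>E1. ip (br H e) e)"
    using orthonormal_trace[OF ip E1(2,1), of "br H"] E1(3) bil ideal by (auto simp: bilinear_def)
  have ne: "E1 \<noteq> {}" using E1(3) A(2) by auto
  have "(\<Sum>e\<in>E1. ricci br ip e) < 0"
  proof -
    have "ricci br ip e < 0" if "e \<in> E1" for e
    proof -
      have "ip e e = 1" using E1(2) that by (simp add: orthonormal_def)
      then have "e \<noteq> 0" using bilinear_lzero[OF inner_product_bilinear[OF ip]] by force
      then show ?thesis using neg by (simp add: negative_ricci_def)
    qed
    then show ?thesis using sum_strict_mono[OF E1(1) ne, of "ricci br ip" "\<lambda>_. 0"] by simp
  qed
  moreover have "(\<Sum>e\<in>E1. ricci br ip e) = - trace_on A (br H) - 1/2 * S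
      + 1/4 * (\<Sum>e\<in>E1. \<Sum>f\<in>E. \<Sum>g\<in>E. (ip (br f g) e)\<^sup>2)"
    using ric by (simp add: sum.distrib sum_subtractf sum_negf tr SS sum_distrib_left[symmetric]
        sum_divide_distrib[symmetric])
  ultimately show ?thesis using half by (simp add: H_def)
qed

section \<open>The Ricci form of structure constants, and degenerations\<close>

text \<open>The Ricci form as a polynomial in the structure constants of an orthonormal basis and the
  coordinates of the vector. This is the shape in which limits of Lie brackets can be taken.\<close>

definition ricci_form :: "'i set \<Rightarrow> ('i \<Rightarrow> 'i \<Rightarrow> 'i \<Rightarrow> real) \<Rightarrow> ('i \<Rightarrow> real) \<Rightarrow> real" where
  "ricci_form I c x =
     - (\<Sum>h\<in>I. (\<Sum>j\<in>I. c h j j) * (\<Sum>p\<in>I. \<Sum>q\<in>I. c h p q * x p * x q))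
     - 1/2 * (\<Sum>j\<in>I. \<Sum>k\<in>I. (\<Sum>p\<in>I. x p * c p j k) * (\<Sum>p\<in>I. x p * c p k j))
     - 1/2 * (\<Sum>j\<in>I. \<Sum>k\<in>I. (\<Sum>p\<in>I. x p * c p j k)\<^sup>2)
     + 1/4 * (\<Sum>j\<in>I. \<Sum>k\<in>I. (\<Sum>p\<in>I. c j k p * x p)\<^sup>2)"

definition negative_form :: "'i set \<Rightarrow> ('i \<Rightarrow> 'i \<Rightarrow> 'i \<Rightarrow> real) \<Rightarrow> bool" where
  "negative_form I c \<longleftrightarrow> (\<forall>x. (\<exists>i\<in>I. x i \<noteq> 0) \<longrightarrow> ricci_form I c x < 0)"

lemma ricci_form_cong:
  assumes "\<And>i j k. i \<in> I \<Longrightarrow> j \<in> I \<Longrightarrow> k \<in> I \<Longrightarrow> c i j k = c' i j k"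
  shows "ricci_form I c x = ricci_form I c' x"
  unfolding ricci_form_def using assms by simp

lemma negative_form_cong:
  assumes "\<And>i j k. i \<in> I \<Longrightarrow> j \<in> I \<Longrightarrow> k \<in> I \<Longrightarrow> c i j k = c' i j k"
  shows "negative_form I c = negative_form I c'"
  unfolding negative_form_def using ricci_form_cong[of I c c', OF assms] by simp

lemma ricci_structure_constants:
  fixes br :: "'a::real_vector \<Rightarrow> 'a \<Rightarrow> 'a" and e :: "'i \<Rightarrow> 'a"
  assumes br: "bilinear br" and ip: "inner_product ip" and fin: "finite I"
    and on: "\<And>i j. i \<in> I \<Longrightarrow> j \<in> I \<Longrightarrow> ip (e i) (e j) = (if i = j then 1 else 0)"
    and sp: "span (e ` I) = UNIV"
  shows "ricci br ip v = ricci_form I (\<lambda>i j k. ip (br (e i) (e j)) (e k)) (\<lambda>i. ip v (e i))"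
proof -
  define E where "E = e ` I"
  define c where "c i j k = ip (br (e i) (e j)) (e k)" for i j k
  define x where "x i = ip v (e i)" for i
  have inj: "inj_on e I" using on by (metis inj_onI zero_neq_one)
  have E: "finite E" "orthonormal ip E" "orthonormal_basis ip E"
    using fin on sp inj by (auto simp: E_def orthonormal_def orthonormal_basis_iff inj_on_eq_iff)
  have sumE: "(\<Sum>u\<in>E. g u) = (\<Sum>i\<in>I. g (e i))" for g :: "'a \<Rightarrow> 'b::comm_monoid_add"
    unfolding E_def by (simp add: sum.reindex[OF inj])
  have ex: "w = (\<Sum>i\<in>I. ip w (e i) *\<^sub>R e i)" for w
    using orthonormal_expansion[OF ip E(2,1), of w] sp unfolding sumE by (simp add: E_def)
  have pars: "ip u w = (\<Sum>i\<in>I. ip u (e i) * ip w (e i))" for u w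
    using orthonormal_parseval[OF ip E(2,1), of u w] sp unfolding sumE by (simp add: E_def)
  note bi = inner_product_bilinear[OF ip]
  have v: "v = (\<Sum>p\<in>I. x p *\<^sub>R e p)" unfolding x_def by (rule ex)
  have brv: "ip (br v (e j)) (e k) = (\<Sum>p\<in>I. x p * c p j k)" for j k
    by (subst v) (simp add: bilinear_sum_scale_left[OF br] bilinear_sum_scale_left[OF bi] c_def)
  have 1: "ip (br (trace_vector br ip) v) v
      = (\<Sum>h\<in>I. (\<Sum>j\<in>I. c h j j) * (\<Sum>p\<in>I. \<Sum>q\<in>I. c h p q * x p * x q))"
  proof -
    have "ip (br (e h) v) v = (\<Sum>p\<in>I. \<Sum>q\<in>I. c h p q * x p * x q)" for h
    proof -
      have "ip (br (e h) v) v = (\<Sum>p\<in>I. x p * ip (br (e h) (e p)) v)"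
        by (subst v) (simp add: bilinear_sum_scale_right[OF br] bilinear_sum_scale_left[OF bi])
      also have "\<dots> = (\<Sum>p\<in>I. x p * (\<Sum>q\<in>I. x q * c h p q))"
        by (subst v) (simp add: bilinear_sum_scale_right[OF bi] c_def)
      finally show ?thesis by (simp add: sum_distrib_left mult_ac)
    qed
    then show ?thesis
      unfolding trace_vector_eq[OF br ip E(3,1)] sumE
      by (simp add: bilinear_sum_scale_left[OF br] bilinear_sum_scale_left[OF bi] c_def)
  qed
  have 2: "(\<Sum>u\<in>E. ip (br v (br v u)) u)
      = (\<Sum>j\<in>I. \<Sum>k\<in>I. (\<Sum>p\<in>I. x p * c p j k) * (\<Sum>p\<in>I. x p * c p k j))"
    unfolding sumE
  proof (intro sum.cong refl)
    fix j assume "j \<in> I"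
    have "ip (br v (br v (e j))) (e j)
        = ip (br v (\<Sum>k\<in>I. ip (br v (e j)) (e k) *\<^sub>R e k)) (e j)"
      by (rule arg_cong[OF ex])
    also have "\<dots> = (\<Sum>k\<in>I. ip (br v (e j)) (e k) * ip (br v (e k)) (e j))"
      by (simp add: bilinear_sum_scale_right[OF br] bilinear_sum_scale_left[OF bi])
    finally show "ip (br v (br v (e j))) (e j)
        = (\<Sum>k\<in>I. (\<Sum>p\<in>I. x p * c p j k) * (\<Sum>p\<in>I. x p * c p k j))"
      by (simp add: brv)
  qed
  have 3: "(\<Sum>u\<in>E. ip (br v u) (br v u)) = (\<Sum>j\<in>I. \<Sum>k\<in>I. (\<Sum>p\<in>I. x p * c p j k)\<^sup>2)"
    unfolding sumE by (subst pars) (simp add: brv power2_eq_square)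
  have 4: "(\<Sum>u\<in>E. \<Sum>w\<in>E. (ip (br u w) v)\<^sup>2) = (\<Sum>j\<in>I. \<Sum>k\<in>I. (\<Sum>p\<in>I. c j k p * x p)\<^sup>2)"
    unfolding sumE by (subst pars) (simp add: c_def x_def)
  show ?thesis
    unfolding ricci_orthonormal_basis[OF br ip E(3,1)] 1 2 3 4 ricci_form_def c_def[symmetric]
      x_def[symmetric] ..
qed

lemma ricci_form_scale: "ricci_form I c (\<lambda>i. r * x i) = r\<^sup>2 * ricci_form I c x"
proof -
  have r1: "(\<Sum>p\<in>I. (r * x p) * f p) = r * (\<Sum>p\<in>I. x p * f p)"
    and r2: "(\<Sum>p\<in>I. f p * (r * x p)) = r * (\<Sum>p\<in>I. f p * x p)" for f
    by (simp_all add: sum_distrib_left mult_ac)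
  have r3: "(\<Sum>p\<in>I. \<Sum>q\<in>I. c h p q * (r * x p) * (r * x q))
      = r\<^sup>2 * (\<Sum>p\<in>I. \<Sum>q\<in>I. c h p q * x p * x q)" for h
    by (simp add: sum_distrib_left mult_ac power2_eq_square)
  have r4: "(r * a) * (r * b) = r\<^sup>2 * (a * b)" "(r * a)\<^sup>2 = r\<^sup>2 * a\<^sup>2"
    "a * (r\<^sup>2 * b) = r\<^sup>2 * (a * b)" for a b
    by (simp_all add: power2_eq_square)
  have t1: "(\<Sum>h\<in>I. (\<Sum>j\<in>I. c h j j) * (\<Sum>p\<in>I. \<Sum>q\<in>I. c h p q * (r * x p) * (r * x q)))
      = r\<^sup>2 * (\<Sum>h\<in>I. (\<Sum>j\<in>I. c h j j) * (\<Sum>p\<in>I. \<Sum>q\<in>I. c h p q * x p * x q))"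
    by (simp only: r3 r4(3) sum_distrib_left[symmetric])
  show ?thesis
    unfolding ricci_form_def t1
    by (simp only: r1 r2 r4(1,2) sum_distrib_left[symmetric]) (simp add: algebra_simps)
qed

text \<open>Bolzano--Weierstrass for finitely many coordinates at once, the index set being a set and not a
  type.\<close>

lemma bounded_family_convergent_subsequence:
  fixes x :: "nat \<Rightarrow> 'i \<Rightarrow> real"
  assumes "finite I" "\<And>t i. i \<in> I \<Longrightarrow> \<bar>x t i\<bar> \<le> 1"
  shows "\<exists>r y. strict_mono (r :: nat \<Rightarrow> nat) \<and> (\<forall>i\<in>I. (\<lambda>t. x (r t) i) \<longlonglongrightarrow> y i)"
  using assms
proof (induction I)
  case empty
  show ?case by (intro exI[of _ "\<lambda>t. t"]) (simp add: strict_mono_def)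
next
  case (insert a I)
  then obtain r y where r: "strict_mono r" "\<forall>i\<in>I. (\<lambda>t. x (r t) i) \<longlonglongrightarrow> y i" by auto
  have "bounded (range (\<lambda>t. x (r t) a))" using insert.prems by (auto simp: bounded_iff)
  then obtain s z where s: "strict_mono s" "(\<lambda>t. x (r (s t)) a) \<longlonglongrightarrow> z"
    using bounded_imp_convergent_subsequence by (auto simp: o_def) blast
  have "(\<lambda>t. x (r (s t)) i) \<longlonglongrightarrow> (y(a := z)) i" if "i \<in> insert a I" for i
  proof (cases "i = a")
    case False
    then show ?thesis using LIMSEQ_subseq_LIMSEQ[OF r(2)[rule_format, of i] s(1)] that
      by (simp add: o_def)
  qed (use s in simp)
  then show ?case using strict_mono_compose[OF r(1) s(1)]
    by (intro exI[of _ "\<lambda>t. r (s t)"] exI[of _ "y(a := z)"]) auto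
qed

text \<open>Negative definiteness is open, by compactness: vectors on which the approximating forms fail to be
  negative can be normalised, and a limit point of them contradicts negativity of the limit form.\<close>

lemma negative_form_stable:
  fixes c :: "nat \<Rightarrow> 'i \<Rightarrow> 'i \<Rightarrow> 'i \<Rightarrow> real"
  assumes fin: "finite I" and neg: "negative_form I c0"
    and lim: "\<And>i j k. i \<in> I \<Longrightarrow> j \<in> I \<Longrightarrow> k \<in> I \<Longrightarrow> (\<lambda>t. c t i j k) \<longlonglongrightarrow> c0 i j k"
  shows "\<exists>t. negative_form I (c t)"
proof (rule ccontr)
  assume "\<nexists>t. negative_form I (c t)"
  then have "\<forall>t. \<exists>x. (\<exists>i\<in>I. x i \<noteq> 0) \<and> ricci_form I (c t) x \<ge> 0"
    by (auto simp: negative_form_def not_less)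
  then obtain x where x: "\<And>t. \<exists>i\<in>I. x t i \<noteq> 0" "\<And>t. ricci_form I (c t) (x t) \<ge> 0" by metis
  \<comment> \<open>the \<open>l\<^sup>1\<close> norm; dividing by it keeps the limit point away from zero\<close>
  define n where "n t = (\<Sum>i\<in>I. \<bar>x t i\<bar>)" for t
  have n: "n t > 0" for t
  proof -
    obtain i where "i \<in> I" "x t i \<noteq> 0" using x(1) by blast
    then show ?thesis unfolding n_def using fin by (intro sum_pos2[of I i]) auto
  qed
  define y where "y t i = (1 / n t) * x t i" for t i
  have y1: "(\<Sum>i\<in>I. \<bar>y t i\<bar>) = 1" for t
    using n[of t] by (simp add: y_def abs_mult n_def sum_divide_distrib[symmetric])
  have yR: "ricci_form I (c t) (y t) \<ge> 0" for t
    using x(2)[of t] unfolding y_def ricci_form_scale by simp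
  have "\<bar>y t i\<bar> \<le> 1" if "i \<in> I" for t i
    using member_le_sum[OF that, of "\<lambda>i. \<bar>y t i\<bar>"] fin y1 by simp
  then obtain r z where r: "strict_mono r" and z: "\<And>i. i \<in> I \<Longrightarrow> (\<lambda>t. y (r t) i) \<longlonglongrightarrow> z i"
    using bounded_family_convergent_subsequence[OF fin, of y] by blast
  have lim': "(\<lambda>t. c (r t) i j k) \<longlonglongrightarrow> c0 i j k" if "i \<in> I" "j \<in> I" "k \<in> I" for i j k
    using LIMSEQ_subseq_LIMSEQ[OF lim[OF that] r] by (simp add: o_def)
  have "(\<lambda>t. \<Sum>i\<in>I. \<bar>y (r t) i\<bar>) \<longlonglongrightarrow> (\<Sum>i\<in>I. \<bar>z i\<bar>)"
    by (intro tendsto_sum tendsto_rabs z)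
  then have "(\<Sum>i\<in>I. \<bar>z i\<bar>) = 1" using y1 by (simp add: LIMSEQ_const_iff)
  then have "\<exists>i\<in>I. z i \<noteq> 0" by (metis abs_zero sum.neutral zero_neq_one)
  then have "ricci_form I c0 z < 0" using neg by (simp add: negative_form_def)
  moreover have "(\<lambda>t. ricci_form I (c (r t)) (y (r t))) \<longlonglongrightarrow> ricci_form I c0 z"
    unfolding ricci_form_def by (intro tendsto_intros z lim')
  then have "ricci_form I c0 z \<ge> 0" by (rule LIMSEQ_le_const) (use yR in auto)
  ultimately show False by simp
qed

lemma inner_product_of_basis:
  fixes e :: "'i \<Rightarrow> 'a::real_vector"
  assumes fin: "finite I"
    and lin: "\<And>i. i \<in> I \<Longrightarrow> linear (\<phi> i)"
    and dual: "\<And>i j. i \<in> I \<Longrightarrow> j \<in> I \<Longrightarrow> \<phi> i (e j) = (if i = j then 1 else (0::real))"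
    and sp: "span (e ` I) = UNIV"
  defines "ip \<equiv> \<lambda>x y. \<Sum>i\<in>I. \<phi> i x * \<phi> i y"
  shows "inner_product ip" and "\<And>x i. i \<in> I \<Longrightarrow> ip x (e i) = \<phi> i x"
proof -
  have bl: "bilinear (\<lambda>x y. \<phi> i x * \<phi> i y)" if "i \<in> I" for i
    using bilinear_real_multI[OF lin lin] that by blast
  have "linear (\<lambda>y. \<Sum>i\<in>I. \<phi> i x * \<phi> i y)" "linear (\<lambda>x. \<Sum>i\<in>I. \<phi> i x * \<phi> i y)" for x y
    by (rule linear_compose_sum, use bl in \<open>simp add: bilinear_def\<close>)+
  then have "bilinear ip" by (simp add: ip_def bilinear_def)
  moreover have "ip x x > 0" if "x \<noteq> 0" for x
  proof -
    have "\<exists>i\<in>I. \<phi> i x \<noteq> 0"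
    proof (rule ccontr)
      assume "\<not> ?thesis"
      then have "(\<Sum>i\<in>I. \<phi> i x *\<^sub>R e i) = 0" by simp
      then show False using dual_family_expansion[of I \<phi> e x] fin lin dual sp that by simp
    qed
    then obtain i where "i \<in> I" "\<phi> i x \<noteq> 0" by blast
    then show ?thesis unfolding ip_def using fin
      by (intro sum_pos2[of I i]) (auto simp: zero_less_mult_iff linorder_neq_iff)
  qed
  ultimately show "inner_product ip" by (simp add: inner_product_def ip_def mult.commute)
  show "ip x (e i) = \<phi> i x" if "i \<in> I" for x i
  proof -
    have "ip x (e i) = (\<Sum>j\<in>I. if j = i then \<phi> j x else 0)"
      unfolding ip_def using that by (intro sum.cong) (auto simp: dual)
    then show ?thesis using fin that by simp
  qed
qed

text \<open>Rescaling the basis by \<open>\<epsilon> ^ w i * m i\<close> multiplies the structure constant with indices \<open>i, j, k\<close> by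
  \<open>\<epsilon> ^ (w k - w i - w j)\<close> times a ratio of the \<open>m\<close>. If the bracket respects the filtration by \<open>w\<close>, no negative
  power of \<open>\<epsilon>\<close> survives, and the limit for \<open>\<epsilon> \<longlonglongrightarrow> 0\<close> is the associated graded bracket. A negative limit
  yields a negative inner product for some small \<open>\<epsilon>\<close>.\<close>

lemma negative_ricci_degeneration:
  fixes br :: "'a::real_vector \<Rightarrow> 'a \<Rightarrow> 'a" and e :: "'i \<Rightarrow> 'a" and w :: "'i \<Rightarrow> nat"
  assumes br: "bilinear br" and fin: "finite I"
    and lin: "\<And>i. i \<in> I \<Longrightarrow> linear (\<phi> i)"
    and dual: "\<And>i j. i \<in> I \<Longrightarrow> j \<in> I \<Longrightarrow> \<phi> i (e j) = (if i = j then 1 else (0::real))"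
    and sp: "span (e ` I) = UNIV"
    and m: "\<And>i. i \<in> I \<Longrightarrow> m i > (0::real)"
    and filt: "\<And>i j k. i \<in> I \<Longrightarrow> j \<in> I \<Longrightarrow> k \<in> I \<Longrightarrow> w k < w i + w j \<Longrightarrow> \<phi> k (br (e i) (e j)) = 0"
    and neg: "negative_form I (\<lambda>i j k. if w k = w i + w j
                then m k / (m i * m j) * \<phi> k (br (e i) (e j)) else 0)" (is "negative_form I ?c0")
  shows "\<exists>ip. inner_product ip \<and> negative_ricci br ip"
proof -
  define \<epsilon> where "\<epsilon> t = 1 / real (Suc t)" for t
  have \<epsilon>: "\<epsilon> t > 0" for t by (simp add: \<epsilon>_def)
  have \<epsilon>0: "\<epsilon> \<longlonglongrightarrow> 0" unfolding \<epsilon>_def by (rule LIMSEQ_Suc[OF lim_1_over_n])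
  define s where "s t i = \<epsilon> t ^ w i * m i" for t i
  have s: "s t i > 0" if "i \<in> I" for t i using \<epsilon> m[OF that] by (simp add: s_def)
  define c where "c t i j k = s t k / (s t i * s t j) * \<phi> k (br (e i) (e j))" for t i j k
  have "(\<lambda>t. c t i j k) \<longlonglongrightarrow> ?c0 i j k" if ijk: "i \<in> I" "j \<in> I" "k \<in> I" for i j k
  proof (cases "w k < w i + w j")
    case True
    then show ?thesis using filt[OF ijk] by (simp add: c_def)
  next
    case False
    then obtain d where d: "w k = w i + w j + d"
      using le_Suc_ex[of "w i + w j" "w k"] by auto
    have c: "c t i j k = m k / (m i * m j) * \<phi> k (br (e i) (e j)) * \<epsilon> t ^ d" for t
    proof -
      have "\<epsilon> t \<noteq> 0" using \<epsilon>[of t] by simp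
      then show ?thesis by (simp add: c_def s_def d power_add)
    qed
    show ?thesis
    proof (cases "d = 0")
      case True
      then show ?thesis by (simp add: c d)
    next
      case False
      have "(\<lambda>t. m k / (m i * m j) * \<phi> k (br (e i) (e j)) * \<epsilon> t ^ d) \<longlonglongrightarrow>
          m k / (m i * m j) * \<phi> k (br (e i) (e j)) * 0 ^ d"
        by (intro tendsto_intros \<epsilon>0)
      then show ?thesis using False by (simp add: c d power_0_left)
    qed
  qed
  then obtain t where t: "negative_form I (c t)"
    using negative_form_stable[OF fin neg, of c] by blast
  define e' where "e' i = (1 / s t i) *\<^sub>R e i" for i
  define \<phi>' where "\<phi>' i v = s t i * \<phi> i v" for i v
  have lin': "linear (\<phi>' i)" if "i \<in> I" for i
    using lin[OF that] unfolding \<phi>'_def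
    by (auto intro!: linearI simp: linear_add linear_scale algebra_simps)
  have dual': "\<phi>' i (e' j) = (if i = j then 1 else 0)" if "i \<in> I" "j \<in> I" for i j
    using s[OF that(1), of t] lin[OF that(1)] dual[OF that]
    by (auto simp: \<phi>'_def e'_def linear_scale)
  have sp': "span (e' ` I) = UNIV"
  proof -
    have "e i \<in> span (e' ` I)" if "i \<in> I" for i
    proof -
      have "e i = s t i *\<^sub>R e' i" using s[OF that, of t] by (simp add: e'_def)
      then show ?thesis using that by (metis imageI span_base span_scale)
    qed
    then have "span (e ` I) \<subseteq> span (e' ` I)" by (intro span_minimal) auto
    then show ?thesis using sp by auto
  qed
  define ip where "ip = (\<lambda>x y. \<Sum>i\<in>I. \<phi>' i x * \<phi>' i y)"
  have ip: "inner_product ip" "\<And>x i. i \<in> I \<Longrightarrow> ip x (e' i) = \<phi>' i x"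
    using inner_product_of_basis[of I \<phi>' e', OF fin lin' dual' sp'] unfolding ip_def by auto
  have "ricci br ip v < 0" if "v \<noteq> 0" for v
  proof -
    have "ricci br ip v = ricci_form I (\<lambda>i j k. ip (br (e' i) (e' j)) (e' k)) (\<lambda>i. ip v (e' i))"
      using dual' ip(2) by (intro ricci_structure_constants br ip(1) fin sp') auto
    also have "\<dots> = ricci_form I (c t) (\<lambda>i. ip v (e' i))"
    proof -
      have "ip (br (e' i) (e' j)) (e' k) = c t i j k" if "i \<in> I" "j \<in> I" "k \<in> I" for i j k
        unfolding ip(2)[OF that(3)] using lin[OF that(3)]
        by (simp add: \<phi>'_def e'_def c_def bilinear_lmul[OF br]
            bilinear_rmul[OF br] linear_scale)
      then show ?thesis unfolding ricci_form_def by simp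
    qed
    also have "\<dots> < 0"
    proof -
      have "\<exists>i\<in>I. ip v (e' i) \<noteq> 0"
      proof (rule ccontr)
        assume "\<not> ?thesis"
        then have "(\<Sum>i\<in>I. \<phi>' i v *\<^sub>R e' i) = 0" using ip(2) by simp
        then show False
          using dual_family_expansion[of I \<phi>' e' v, OF fin lin' dual'] sp' that by simp
      qed
      then show ?thesis using t by (simp add: negative_form_def)
    qed
    finally show ?thesis .
  qed
  then show ?thesis using ip(1) by (auto simp: negative_ricci_def)
qed

section \<open>Curvature of the graded filiform model\<close>

text \<open>The associated graded algebra in an orthonormal basis: an abelian factor with indices in \<open>K\<close> acts
  diagonally by the weights \<open>d\<close> on the filiform algebra with indices \<open>1, \<dots>, l\<close>, whose brackets
  carry the free scale factors \<open>\<mu>\<close>.\<close>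

definition filiform_constants ::
  "nat \<Rightarrow> nat set \<Rightarrow> (nat \<Rightarrow> nat \<Rightarrow> real) \<Rightarrow> (nat \<Rightarrow> real) \<Rightarrow> nat \<Rightarrow> nat \<Rightarrow> nat \<Rightarrow> real" where
  "filiform_constants l K d \<mu> i j k =
     (if k \<notin> {1..l} then 0
      else if i \<in> K \<and> j = k then d k i
      else if j \<in> K \<and> i = k then - d k j
      else if i = 1 \<and> j \<in> {2..<l} \<and> k = Suc j then \<mu> j
      else if j = 1 \<and> i \<in> {2..<l} \<and> k = Suc i then - \<mu> i
      else 0)"

text \<open>The hypothesis on traces says that \<open>H\<close> is the basis vector with index \<open>h0\<close>. The sum \<open>S\<close> of the squared
  norms of the brackets between the diagonal and the filiform part cancels as it does for an abelian
  ideal. What remains is diagonal in the filiform directions, and minus the trace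
  form of the weights on the complement.\<close>

lemma ricci_form_filiform_constants:
  fixes d :: "nat \<Rightarrow> nat \<Rightarrow> real" and \<mu> x :: "nat \<Rightarrow> real"
  assumes l: "2 \<le> l" and K: "finite K" "K \<inter> {1..l} = {}" "h0 \<in> K"
    and tr: "\<And>h. h \<in> K \<Longrightarrow> (\<Sum>i\<in>{1..l}. d i h) = (if h = h0 then 1 else 0)"
  shows "ricci_form ({1..l} \<union> K) (filiform_constants l K d \<mu>) x =
     - (\<Sum>i\<in>{1..l}. (\<Sum>h\<in>K. x h * d i h)\<^sup>2)
     - (x 1)\<^sup>2 * (d 1 h0 + (\<Sum>i\<in>{2..<l}. (\<mu> i)\<^sup>2) / 2)
     - (\<Sum>i\<in>{2..l}. (x i)\<^sup>2 * (d i h0 + (if i < l then (\<mu> i)\<^sup>2 / 2 else 0)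
                                    - (if 2 < i then (\<mu> (i - 1))\<^sup>2 / 2 else 0)))"
proof -
  define J where "J = {1..l}"
  define I where "I = J \<union> K"
  define c where "c = filiform_constants l K d \<mu>"
  define D where "D i = (\<Sum>h\<in>K. x h * d i h)" for i
  have fin: "finite J" "finite K" "finite I" and disj: "J \<inter> K = {}"
    using K by (auto simp: J_def I_def)
  have JK: "i \<notin> K" if "i \<in> J" for i using that disj by blast
  have one: "1 \<in> J" "1 \<notin> K" using l JK by (auto simp: J_def)
  have nK: "Suc j \<notin> K" "j \<notin> K" if "j \<in> {2..<l}" for j
    using that JK by (auto simp: J_def)
  have cdef: "c i j k =
     (if k \<notin> J then 0
      else if i \<in> K \<and> j = k then d k i
      else if j \<in> K \<and> i = k then - d k j
      else if i = 1 \<and> j \<in> {2..<l} \<and> k = Suc j then \<mu> j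
      else if j = 1 \<and> i \<in> {2..<l} \<and> k = Suc i then - \<mu> i
      else 0)" for i j k
    unfolding c_def filiform_constants_def J_def ..
  have split: "(\<Sum>i\<in>I. f i) = (\<Sum>i\<in>J. f i) + (\<Sum>i\<in>K. f i)" for f :: "nat \<Rightarrow> real"
    unfolding I_def by (rule sum.union_disjoint[OF fin(1,2) disj])
  \<comment> \<open>the matrix of \<open>ad x\<close>; ordering the indices as \<open>K, 1, \<dots>, l\<close> makes it upper triangular, so that the
    trace of its square is the sum of the squared diagonal entries \<open>D i\<close>\<close>
  define A where "A j k = (\<Sum>p\<in>I. x p * c p j k)" for j k
  have A0: "A j k = 0" if "k \<notin> J" for j k
    using that by (simp add: A_def cdef)
  have AK: "A j k = - x k * d k j" if "j \<in> K" "k \<in> J" for j k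
  proof -
    have "A j k = (\<Sum>p\<in>I. if p = k then - x k * d k j else 0)"
      unfolding A_def using that JK one nK by (intro sum.cong refl) (auto simp: cdef)
    then show ?thesis using that fin by (simp add: I_def)
  qed
  have AJ: "A j k = (if j = k then D j else if j \<in> {2..<l} \<and> k = Suc j then x 1 * \<mu> j
      else if j = 1 \<and> k \<in> {3..l} then - x (k - 1) * \<mu> (k - 1) else 0)"
    if "j \<in> J" "k \<in> J" for j k
  proof -
    have "(\<Sum>p\<in>K. x p * c p j k) = (\<Sum>p\<in>K. if j = k then x p * d k p else 0)"
      using that JK one nK by (intro sum.cong refl) (auto simp: cdef)
    moreover have "(\<Sum>p\<in>J. x p * c p j k) = (\<Sum>p\<in>J.
        (if p = 1 then (if j \<in> {2..<l} \<and> k = Suc j then x 1 * \<mu> j else 0) else 0)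
        + (if p = k - 1 then (if j = 1 \<and> k \<in> {3..l} then - x (k - 1) * \<mu> (k - 1) else 0) else 0))"
      using that JK one nK by (intro sum.cong refl) (auto simp: cdef)
    moreover have "\<dots> = (if j \<in> {2..<l} \<and> k = Suc j then x 1 * \<mu> j else 0)
        + (if j = 1 \<and> k \<in> {3..l} then - x (k - 1) * \<mu> (k - 1) else 0)"
      unfolding sum.distrib using fin(1) one by (simp add: sum.delta) (auto simp: J_def)
    ultimately show ?thesis unfolding A_def split by (auto simp: D_def)
  qed
  have t1: "(\<Sum>h\<in>I. (\<Sum>j\<in>I. c h j j) * (\<Sum>p\<in>I. \<Sum>q\<in>I. c h p q * x p * x q))
      = (\<Sum>i\<in>J. d i h0 * (x i)\<^sup>2)"
  proof -
    have "(\<Sum>j\<in>I. c h j j) = (if h = h0 then 1 else 0)" if "h \<in> I" for h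
    proof -
      have "c h j j = (if h \<in> K then d j h else 0)" if "j \<in> J" for j
        using that JK by (auto simp: cdef)
      moreover have "c h j j = 0" if "j \<in> K" for j
        using that disj by (auto simp: cdef)
      ultimately have "(\<Sum>j\<in>I. c h j j) = (\<Sum>j\<in>J. if h \<in> K then d j h else 0)"
        unfolding split by simp
      then show ?thesis using tr K(3) by (cases "h \<in> K") (auto simp: J_def)
    qed
    then have "(\<Sum>h\<in>I. (\<Sum>j\<in>I. c h j j) * (\<Sum>p\<in>I. \<Sum>q\<in>I. c h p q * x p * x q))
        = (\<Sum>h\<in>I. if h = h0 then (\<Sum>p\<in>I. \<Sum>q\<in>I. c h p q * x p * x q) else 0)"
      by (intro sum.cong) auto
    also have "\<dots> = (\<Sum>p\<in>I. \<Sum>q\<in>I. c h0 p q * x p * x q)"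
      using fin K(3) by (simp add: I_def)
    also have "\<dots> = (\<Sum>p\<in>I. \<Sum>q\<in>I. if q = p then (if p \<in> J then d p h0 * (x p)\<^sup>2 else 0) else 0)"
      using K(3) JK one nK
      by (intro sum.cong refl) (auto simp: cdef power2_eq_square)
    also have "\<dots> = (\<Sum>p\<in>I. if p \<in> J then d p h0 * (x p)\<^sup>2 else 0)"
      using fin by simp
    also have "\<dots> = (\<Sum>p\<in>J. d p h0 * (x p)\<^sup>2)"
      unfolding split using disj by (auto intro!: sum.neutral)
    finally show ?thesis .
  qed
  have t2: "(\<Sum>j\<in>I. \<Sum>k\<in>I. A j k * A k j) = (\<Sum>i\<in>J. (D i)\<^sup>2)"
  proof -
    have "A j k * A k j = (if k = j then (if j \<in> J then (D j)\<^sup>2 else 0) else 0)"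
      if "j \<in> I" "k \<in> I" for j k
    proof (cases "j \<in> J \<and> k \<in> J")
      case True
      then show ?thesis by (auto simp: AJ power2_eq_square)
    next
      case False
      then show ?thesis using A0 by auto
    qed
    then have "(\<Sum>j\<in>I. \<Sum>k\<in>I. A j k * A k j)
        = (\<Sum>j\<in>I. \<Sum>k\<in>I. if k = j then (if j \<in> J then (D j)\<^sup>2 else 0) else 0)"
      by (intro sum.cong refl) auto
    also have "\<dots> = (\<Sum>j\<in>I. if j \<in> J then (D j)\<^sup>2 else 0)" using fin by simp
    also have "\<dots> = (\<Sum>i\<in>J. (D i)\<^sup>2)"
      unfolding split using disj by (auto intro!: sum.neutral)
    finally show ?thesis .
  qed
  define S where "S = (\<Sum>h\<in>K. \<Sum>i\<in>J. (d i h)\<^sup>2 * (x i)\<^sup>2)"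
  have t3: "(\<Sum>j\<in>I. \<Sum>k\<in>I. (A j k)\<^sup>2) = (\<Sum>i\<in>J. (D i)\<^sup>2) + S
      + (x 1)\<^sup>2 * (\<Sum>i\<in>{2..<l}. (\<mu> i)\<^sup>2) + (\<Sum>i\<in>{2..<l}. (\<mu> i)\<^sup>2 * (x i)\<^sup>2)"
  proof -
    have "A j k = 0" if "k \<in> K" for j k using A0 that disj by blast
    then have "(\<Sum>k\<in>I. (A j k)\<^sup>2) = (\<Sum>k\<in>J. (A j k)\<^sup>2)" for j
      by (simp add: split)
    then have "(\<Sum>j\<in>I. \<Sum>k\<in>I. (A j k)\<^sup>2) = (\<Sum>j\<in>J. \<Sum>k\<in>J. (A j k)\<^sup>2) + (\<Sum>j\<in>K. \<Sum>k\<in>J. (A j k)\<^sup>2)"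
      by (simp add: split)
    also have "(\<Sum>j\<in>K. \<Sum>k\<in>J. (A j k)\<^sup>2) = S"
      unfolding S_def by (intro sum.cong refl) (simp add: AK power_mult_distrib mult.commute)
    also have "(\<Sum>j\<in>J. \<Sum>k\<in>J. (A j k)\<^sup>2)
      = (\<Sum>j\<in>J. \<Sum>k\<in>J. (if k = j then (D j)\<^sup>2 else 0)
           + (if k = Suc j then (if j \<in> {2..<l} then (x 1)\<^sup>2 * (\<mu> j)\<^sup>2 else 0) else 0)
           + (if j = 1 then (if k \<in> {3..l} then (\<mu> (k - 1))\<^sup>2 * (x (k - 1))\<^sup>2 else 0) else 0))"
      by (intro sum.cong refl) (auto simp: AJ power_mult_distrib)
    also have "\<dots> = (\<Sum>j\<in>J. (D j)\<^sup>2)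
        + (\<Sum>j\<in>J. if j \<in> {2..<l} then (x 1)\<^sup>2 * (\<mu> j)\<^sup>2 else 0)
        + (\<Sum>k\<in>J. if k \<in> {3..l} then (\<mu> (k - 1))\<^sup>2 * (x (k - 1))\<^sup>2 else 0)"
    proof -
      have "(\<Sum>j\<in>J. \<Sum>k\<in>J. if k = j then (D j)\<^sup>2 else 0) = (\<Sum>j\<in>J. (D j)\<^sup>2)"
        using fin by simp
      moreover have "(\<Sum>j\<in>J. \<Sum>k\<in>J. if k = Suc j then (if j \<in> {2..<l} then (x 1)\<^sup>2 * (\<mu> j)\<^sup>2 else 0) else 0)
          = (\<Sum>j\<in>J. if j \<in> {2..<l} then (x 1)\<^sup>2 * (\<mu> j)\<^sup>2 else 0)"
        using fin by (intro sum.cong refl) (simp, auto simp: J_def)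
      moreover have "(\<Sum>j\<in>J. \<Sum>k\<in>J. if j = 1 then (if k \<in> {3..l} then (\<mu> (k - 1))\<^sup>2 * (x (k - 1))\<^sup>2 else 0) else 0)
          = (\<Sum>k\<in>J. if k \<in> {3..l} then (\<mu> (k - 1))\<^sup>2 * (x (k - 1))\<^sup>2 else 0)"
        using fin one by (subst sum.swap) simp
      ultimately show ?thesis by (simp only: sum.distrib)
    qed
    also have "(\<Sum>j\<in>J. if j \<in> {2..<l} then (x 1)\<^sup>2 * (\<mu> j)\<^sup>2 else 0)
        = (x 1)\<^sup>2 * (\<Sum>i\<in>{2..<l}. (\<mu> i)\<^sup>2)"
      unfolding sum_distrib_left
      by (rule sum.mono_neutral_cong_right) (auto simp: J_def)
    also have "(\<Sum>k\<in>J. if k \<in> {3..l} then (\<mu> (k - 1))\<^sup>2 * (x (k - 1))\<^sup>2 else 0)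
        = (\<Sum>i\<in>{2..<l}. (\<mu> i)\<^sup>2 * (x i)\<^sup>2)"
    proof -
      have "(\<Sum>k\<in>J. if k \<in> {3..l} then (\<mu> (k - 1))\<^sup>2 * (x (k - 1))\<^sup>2 else 0)
          = (\<Sum>k\<in>{3..l}. (\<mu> (k - 1))\<^sup>2 * (x (k - 1))\<^sup>2)"
        by (rule sum.mono_neutral_cong_right) (auto simp: J_def)
      also have "\<dots> = (\<Sum>i\<in>{2..<l}. (\<mu> i)\<^sup>2 * (x i)\<^sup>2)"
        by (rule sum.reindex_bij_witness[of _ Suc "\<lambda>k. k - 1"]) auto
      finally show ?thesis .
    qed
    finally show ?thesis by simp
  qed
  have t4: "(\<Sum>j\<in>I. \<Sum>k\<in>I. (\<Sum>p\<in>I. c j k p * x p)\<^sup>2)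
      = 2 * S + 2 * (\<Sum>i\<in>{2..<l}. (\<mu> i)\<^sup>2 * (x (Suc i))\<^sup>2)"
  proof -
    define B where "B j k = (\<Sum>p\<in>I. c j k p * x p)" for j k
    have B: "B j k = y" if "\<And>p. p \<in> J \<Longrightarrow> c j k p * x p = (if p = q then y else 0)" "q \<in> J" for j k q y
    proof -
      have "B j k = (\<Sum>p\<in>J. if p = q then y else 0)"
        unfolding B_def split using that disj
        by (auto simp: cdef intro!: sum.neutral)
      then show ?thesis using fin that(2) by simp
    qed
    have BKK: "B j k = 0" if "j \<in> K" "k \<in> K" for j k
      by (rule B[where q = 1]) (use that JK one nK in \<open>auto simp: cdef\<close>)
    have BKJ: "B j k = d k j * x k" if "j \<in> K" "k \<in> J" for j k
      by (rule B[where q = k]) (use that JK one nK in \<open>auto simp: cdef\<close>)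
    have BJK: "B k j = - d k j * x k" if "j \<in> K" "k \<in> J" for j k
      by (rule B[where q = k]) (use that JK one nK in \<open>auto simp: cdef\<close>)
    have BJJ: "(B j k)\<^sup>2 = (if j = 1 then (if k \<in> {2..<l} then (\<mu> k)\<^sup>2 * (x (Suc k))\<^sup>2 else 0) else 0)
        + (if k = 1 then (if j \<in> {2..<l} then (\<mu> j)\<^sup>2 * (x (Suc j))\<^sup>2 else 0) else 0)"
      if "j \<in> J" "k \<in> J" for j k
    proof -
      consider "j = 1" "k \<in> {2..<l}" | "k = 1" "j \<in> {2..<l}"
        | "\<not> (j = 1 \<and> k \<in> {2..<l})" "\<not> (k = 1 \<and> j \<in> {2..<l})" by blast
      then show ?thesis
      proof cases
        case 1
        have "B j k = \<mu> k * x (Suc k)"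
          by (rule B[where q = "Suc k"]) (use 1 that JK one nK in \<open>auto simp: cdef J_def\<close>)
        then show ?thesis using 1 by (simp add: power_mult_distrib)
      next
        case 2
        have "B j k = - \<mu> j * x (Suc j)"
          by (rule B[where q = "Suc j"]) (use 2 that JK one nK in \<open>auto simp: cdef J_def\<close>)
        then show ?thesis using 2 by (simp add: power_mult_distrib)
      next
        case 3
        have "B j k = 0"
          by (rule B[where q = 1]) (use 3 that JK one nK in \<open>auto simp: cdef\<close>)
        then show ?thesis using 3 by auto
      qed
    qed
    have "(\<Sum>j\<in>I. \<Sum>k\<in>I. (B j k)\<^sup>2) = (\<Sum>j\<in>J. \<Sum>k\<in>J. (B j k)\<^sup>2) + (\<Sum>j\<in>J. \<Sum>k\<in>K. (B j k)\<^sup>2)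
        + (\<Sum>j\<in>K. \<Sum>k\<in>J. (B j k)\<^sup>2) + (\<Sum>j\<in>K. \<Sum>k\<in>K. (B j k)\<^sup>2)"
      by (simp add: split sum.distrib)
    also have "(\<Sum>j\<in>K. \<Sum>k\<in>K. (B j k)\<^sup>2) = 0" by (simp add: BKK)
    also have "(\<Sum>j\<in>K. \<Sum>k\<in>J. (B j k)\<^sup>2) = S"
      unfolding S_def by (intro sum.cong refl) (simp add: BKJ power_mult_distrib)
    also have "(\<Sum>j\<in>J. \<Sum>k\<in>K. (B j k)\<^sup>2) = S"
      unfolding S_def by (subst sum.swap, intro sum.cong refl) (simp add: BJK power_mult_distrib)
    also have "(\<Sum>j\<in>J. \<Sum>k\<in>J. (B j k)\<^sup>2)
        = (\<Sum>k\<in>J. if k \<in> {2..<l} then (\<mu> k)\<^sup>2 * (x (Suc k))\<^sup>2 else 0)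
          + (\<Sum>j\<in>J. if j \<in> {2..<l} then (\<mu> j)\<^sup>2 * (x (Suc j))\<^sup>2 else 0)"
    proof -
      have "(\<Sum>j\<in>J. \<Sum>k\<in>J. (B j k)\<^sup>2)
        = (\<Sum>j\<in>J. \<Sum>k\<in>J. if j = 1 then (if k \<in> {2..<l} then (\<mu> k)\<^sup>2 * (x (Suc k))\<^sup>2 else 0) else 0)
          + (\<Sum>j\<in>J. \<Sum>k\<in>J. if k = 1 then (if j \<in> {2..<l} then (\<mu> j)\<^sup>2 * (x (Suc j))\<^sup>2 else 0) else 0)"
        unfolding sum.distrib[symmetric] by (intro sum.cong refl) (simp add: BJJ)
      also have "(\<Sum>j\<in>J. \<Sum>k\<in>J. if j = 1 then (if k \<in> {2..<l} then (\<mu> k)\<^sup>2 * (x (Suc k))\<^sup>2 else 0) else 0)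
          = (\<Sum>k\<in>J. if k \<in> {2..<l} then (\<mu> k)\<^sup>2 * (x (Suc k))\<^sup>2 else 0)"
        using fin one by (subst sum.swap) simp
      also have "(\<Sum>j\<in>J. \<Sum>k\<in>J. if k = 1 then (if j \<in> {2..<l} then (\<mu> j)\<^sup>2 * (x (Suc j))\<^sup>2 else 0) else 0)
          = (\<Sum>j\<in>J. if j \<in> {2..<l} then (\<mu> j)\<^sup>2 * (x (Suc j))\<^sup>2 else 0)"
        using fin one by simp
      finally show ?thesis .
    qed
    also have "(\<Sum>j\<in>J. if j \<in> {2..<l} then (\<mu> j)\<^sup>2 * (x (Suc j))\<^sup>2 else 0)
        = (\<Sum>i\<in>{2..<l}. (\<mu> i)\<^sup>2 * (x (Suc i))\<^sup>2)"
      by (rule sum.mono_neutral_cong_right) (auto simp: J_def)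
    finally show ?thesis unfolding B_def by simp
  qed
  have shift: "(\<Sum>i\<in>{2..<l}. (\<mu> i)\<^sup>2 * (x (Suc i))\<^sup>2)
      = (\<Sum>i\<in>{2..l}. if 2 < i then (\<mu> (i - 1))\<^sup>2 * (x i)\<^sup>2 else 0)"
  proof -
    have "(\<Sum>i\<in>{2..<l}. (\<mu> i)\<^sup>2 * (x (Suc i))\<^sup>2) = (\<Sum>i\<in>{3..l}. (\<mu> (i - 1))\<^sup>2 * (x i)\<^sup>2)"
      by (rule sum.reindex_bij_witness[of _ "\<lambda>k. k - 1" Suc]) auto
    also have "\<dots> = (\<Sum>i\<in>{2..l}. if 2 < i then (\<mu> (i - 1))\<^sup>2 * (x i)\<^sup>2 else 0)"
      by (rule sum.mono_neutral_cong_left) auto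
    finally show ?thesis .
  qed
  have top: "(\<Sum>i\<in>{2..<l}. (\<mu> i)\<^sup>2 * (x i)\<^sup>2)
      = (\<Sum>i\<in>{2..l}. if i < l then (\<mu> i)\<^sup>2 * (x i)\<^sup>2 else 0)"
    by (rule sum.mono_neutral_cong_left) auto
  have first: "(\<Sum>i\<in>J. d i h0 * (x i)\<^sup>2) = d 1 h0 * (x 1)\<^sup>2 + (\<Sum>i\<in>{2..l}. d i h0 * (x i)\<^sup>2)"
    using l by (simp add: J_def sum.atLeast_Suc_atMost numeral_2_eq_2)
  have last: "(\<Sum>i\<in>{2..l}. (x i)\<^sup>2 * (d i h0 + (if i < l then (\<mu> i)\<^sup>2 / 2 else 0)
        - (if 2 < i then (\<mu> (i - 1))\<^sup>2 / 2 else 0)))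
      = (\<Sum>i\<in>{2..l}. d i h0 * (x i)\<^sup>2) + 1/2 * (\<Sum>i\<in>{2..<l}. (\<mu> i)\<^sup>2 * (x i)\<^sup>2)
        - 1/2 * (\<Sum>i\<in>{2..<l}. (\<mu> i)\<^sup>2 * (x (Suc i))\<^sup>2)"
    unfolding shift top sum_distrib_left sum.distrib[symmetric] sum_subtractf[symmetric]
    by (intro sum.cong refl) (auto simp: algebra_simps)
  have "ricci_form I c x = - (\<Sum>i\<in>J. d i h0 * (x i)\<^sup>2) - 1/2 * (\<Sum>i\<in>J. (D i)\<^sup>2)
     - 1/2 * ((\<Sum>i\<in>J. (D i)\<^sup>2) + S
      + (x 1)\<^sup>2 * (\<Sum>i\<in>{2..<l}. (\<mu> i)\<^sup>2) + (\<Sum>i\<in>{2..<l}. (\<mu> i)\<^sup>2 * (x i)\<^sup>2))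
     + 1/4 * (2 * S + 2 * (\<Sum>i\<in>{2..<l}. (\<mu> i)\<^sup>2 * (x (Suc i))\<^sup>2))"
    unfolding ricci_form_def A_def[symmetric] t1 t2 t3 t4 ..
  then have "ricci_form I c x = - (\<Sum>i\<in>J. (D i)\<^sup>2)
     - (x 1)\<^sup>2 * (d 1 h0 + (\<Sum>i\<in>{2..<l}. (\<mu> i)\<^sup>2) / 2)
     - (\<Sum>i\<in>{2..l}. (x i)\<^sup>2 * (d i h0 + (if i < l then (\<mu> i)\<^sup>2 / 2 else 0)
                                    - (if 2 < i then (\<mu> (i - 1))\<^sup>2 / 2 else 0)))"
    unfolding last first by (simp add: algebra_simps)
  then show ?thesis unfolding I_def J_def c_def D_def .
qed

text \<open>If the filiform coordinates vanish then only the squares of the weights are left; they detect the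
  complement because the weights separate its points (assumption \<open>faithful\<close>).\<close>

lemma negative_form_filiform_constants:
  fixes d :: "nat \<Rightarrow> nat \<Rightarrow> real" and \<mu> :: "nat \<Rightarrow> real"
  assumes l: "2 \<le> l" and K: "finite K" "K \<inter> {1..l} = {}" "h0 \<in> K"
    and tr: "\<And>h. h \<in> K \<Longrightarrow> (\<Sum>i\<in>{1..l}. d i h) = (if h = h0 then 1 else 0)"
    and faithful: "\<And>x h. (\<And>i. i \<in> {1..l} \<Longrightarrow> (\<Sum>h\<in>K. x h * d i h) = 0) \<Longrightarrow> h \<in> K \<Longrightarrow> x h = 0"
    and pos1: "d 1 h0 + (\<Sum>i\<in>{2..<l}. (\<mu> i)\<^sup>2) / 2 > 0"
    and pos: "\<And>i. i \<in> {2..l} \<Longrightarrow> d i h0 + (if i < l then (\<mu> i)\<^sup>2 / 2 else 0)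
                - (if 2 < i then (\<mu> (i - 1))\<^sup>2 / 2 else 0) > 0"
  shows "negative_form ({1..l} \<union> K) (filiform_constants l K d \<mu>)"
  unfolding negative_form_def
proof (intro allI impI)
  fix x :: "nat \<Rightarrow> real"
  assume x: "\<exists>i\<in>{1..l} \<union> K. x i \<noteq> 0"
  let ?D = "\<Sum>i\<in>{1..l}. (\<Sum>h\<in>K. x h * d i h)\<^sup>2"
  let ?a = "(x 1)\<^sup>2 * (d 1 h0 + (\<Sum>i\<in>{2..<l}. (\<mu> i)\<^sup>2) / 2)"
  let ?g = "\<lambda>i. (x i)\<^sup>2 * (d i h0 + (if i < l then (\<mu> i)\<^sup>2 / 2 else 0)
                - (if 2 < i then (\<mu> (i - 1))\<^sup>2 / 2 else 0))"
  have nn: "?D \<ge> 0" "?a \<ge> 0" "\<And>i. i \<in> {2..l} \<Longrightarrow> ?g i \<ge> 0"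
    using pos1 by (intro sum_nonneg zero_le_power2)
      (use pos1 in simp, intro mult_nonneg_nonneg zero_le_power2 less_imp_le pos)
  then have nn3: "(\<Sum>i\<in>{2..l}. ?g i) \<ge> 0" by (intro sum_nonneg) auto
  have "\<not> (?D = 0 \<and> ?a = 0 \<and> (\<Sum>i\<in>{2..l}. ?g i) = 0)"
  proof
    assume z: "?D = 0 \<and> ?a = 0 \<and> (\<Sum>i\<in>{2..l}. ?g i) = 0"
    have "x 1 = 0" using z pos1 by auto
    moreover have "x i = 0" if i: "i \<in> {2..l}" for i
    proof -
      have "?g i = 0" using z nn(3) i sum_nonneg_eq_0_iff[of "{2..l}" ?g] by blast
      then show ?thesis using pos[OF i] by (simp only: mult_eq_0_iff power_eq_0_iff) auto
    qed
    moreover have "x h = 0" if "h \<in> K" for h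
    proof (rule faithful[OF _ that])
      show "(\<Sum>h\<in>K. x h * d i h) = 0" if "i \<in> {1..l}" for i
        using z that sum_nonneg_eq_0_iff[of "{1..l}" "\<lambda>i. (\<Sum>h\<in>K. x h * d i h)\<^sup>2"] by simp
    qed
    moreover have "i = 1 \<or> i \<in> {2..l}" if "i \<in> {1..l}" for i using that by auto
    ultimately show False using x by blast
  qed
  moreover have formula: "ricci_form ({1..l} \<union> K) (filiform_constants l K d \<mu>) x
      = - ?D - ?a - (\<Sum>i\<in>{2..l}. ?g i)"
    by (rule ricci_form_filiform_constants[OF l K]) (rule tr)
  ultimately have "?D + ?a + (\<Sum>i\<in>{2..l}. ?g i) > 0" using nn nn3 by linarith
  then show "ricci_form ({1..l} \<union> K) (filiform_constants l K d \<mu>) x < 0"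
    using formula by linarith
qed

text \<open>Write \<open>x i = (\<mu> i)^2 / 2\<close>. The expressions with \<open>3 \<le> i\<close> all take the value \<open>\<delta>\<close>
  if \<open>x i\<close> is the tail sum of \<open>d\<close> beyond \<open>i\<close> minus \<open>(l - i) * \<delta>\<close>. The tail beyond \<open>i\<close> is
  \<open>(l - i) * g i\<close> for the average \<open>g i\<close> of its first and last term. An arithmetic progression
  being monotone, \<open>g i\<close> is at least the smaller of \<open>g 1\<close> and \<open>d l\<close>, both positive, so
  \<open>\<delta>\<close> can be half of that minimum; the inequality for \<open>i = 2\<close> is \<open>(l - 2) * \<delta> < (l - 1) * g 1\<close>.

  The inequality for \<open>a + \<Sum> (\<mu> i)^2 / 2\<close>, and the positivity of \<open>a + \<Sum> d\<close>, can fail only for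
  \<open>a < 0\<close>. The former then follows from the single term \<open>x (l - 2) = 2 * d l - a - 2 * \<delta>\<close>, which exists because of
  \<open>l \<ge> 4\<close>.\<close>

lemma filiform_weights_feasible:
  fixes a b :: real
  assumes l: "4 \<le> l" and d: "\<And>i. i \<in> {2..l} \<Longrightarrow> d i = b + real (i - 2) * a"
    and centre: "d l > 0" and ideal: "(\<Sum>i\<in>{2..l}. d i) > 0"
  shows "a + (\<Sum>i\<in>{2..l}. d i) > 0"
    and "\<exists>\<mu>. (\<forall>i. \<mu> i > 0) \<and> a + (\<Sum>i\<in>{2..<l}. (\<mu> i)\<^sup>2) / 2 > 0 \<and>
      (\<forall>i\<in>{2..l}. d i + (if i < l then (\<mu> i)\<^sup>2 / 2 else 0)
                       - (if 2 < i then (\<mu> (i - 1))\<^sup>2 / 2 else 0) > 0)"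
proof -
  define L where "L = real l"
  have L: "L \<ge> 4" using l by (simp add: L_def)
  define g where "g i = b + (real i + L - 3) * a / 2" for i
  have dl: "d l = b + (L - 2) * a" using d[of l] l by (simp add: L_def of_nat_diff)
  have gauss: "(\<Sum>i\<in>{2..n}. d i) = (real n - 1) * (b + (real n - 2) * a / 2)" if "1 \<le> n" "n \<le> l" for n
    using that
  proof (induction n rule: dec_induct)
    case (step n)
    then have "{2..Suc n} = insert (Suc n) {2..n}" by auto
    then have "(\<Sum>i\<in>{2..Suc n}. d i) = d (Suc n) + (\<Sum>i\<in>{2..n}. d i)" by simp
    also have "d (Suc n) = b + (real n - 1) * a"
      using step d[of "Suc n"] by (simp add: of_nat_diff)
    finally show ?case using step by (simp add: field_simps)
  qed simp
  have g1: "g 1 > 0"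
  proof -
    have "(L - 1) * g 1 > 0" using ideal gauss[of l] l by (simp add: g_def L_def)
    then show ?thesis using L by (simp add: zero_less_mult_iff)
  qed
  have dl_g1: "d l = g 1 + (L - 2) * a / 2" by (simp add: dl g_def field_simps)
  show "a + (\<Sum>i\<in>{2..l}. d i) > 0"
  proof (cases "a \<ge> 0")
    case False
    have "2 * (- a) \<le> (L - 2) * (- a)" using L False by (intro mult_right_mono) auto
    then have "- a < g 1" using centre dl_g1 by (simp add: field_simps)
    also have "g 1 \<le> (L - 1) * g 1" using L g1 by simp
    finally show ?thesis using gauss[of l] l by (simp add: g_def L_def)
  qed (use ideal in simp)
  define \<delta> where "\<delta> = min (g 1) (d l) / 2"
  have \<delta>: "\<delta> > 0" "\<delta> < g 1" "\<delta> < d l" using g1 centre by (auto simp: \<delta>_def min_def)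
  have g: "g i > \<delta>" if "i \<in> {1..<l}" for i
  proof (cases "a \<ge> 0")
    case True
    then have "g 1 \<le> g i" using that
      by (simp add: g_def divide_right_mono mult_right_mono)
    then show ?thesis using \<delta> by simp
  next
    case False
    have "real i + 1 \<le> L" using that by (simp add: L_def flip: of_nat_Suc)
    then have "(2 * L - 4) * a \<le> (real i + L - 3) * a" using False by (intro mult_right_mono_neg) auto
    then have "d l \<le> g i" by (simp add: g_def dl field_simps)
    then show ?thesis using \<delta> by simp
  qed
  define x where "x i = (L - real i) * (g i - \<delta>)" for i
  define \<mu> where "\<mu> i = (if i \<in> {2..<l} then sqrt (2 * x i) else 1)" for i
  have x: "x i > 0" if "i \<in> {2..<l}" for i
    using g[of i] that by (simp add: x_def L_def)
  have \<mu>: "\<mu> i > 0" for i using x by (simp add: \<mu>_def)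
  have \<mu>x: "(\<mu> i)\<^sup>2 / 2 = x i" if "i \<in> {2..<l}" for i using x[OF that] that by (simp add: \<mu>_def)
  have c1: "a + (\<Sum>i\<in>{2..<l}. (\<mu> i)\<^sup>2) / 2 > 0"
  proof -
    have "l - 2 \<in> {2..<l}" using l by auto
    then have "x (l - 2) \<le> (\<Sum>i\<in>{2..<l}. x i)"
      using x by (intro member_le_sum) (auto intro: less_imp_le)
    moreover have "x (l - 2) = 2 * d l - a - 2 * \<delta>"
      using l by (simp add: x_def g_def dl L_def of_nat_diff field_simps)
    moreover have "(\<Sum>i\<in>{2..<l}. x i) \<ge> 0" by (intro sum_nonneg) (use x less_imp_le in blast)
    moreover have "2 * d l - 2 * \<delta> > 0" using \<delta> by simp
    ultimately have "a + (\<Sum>i\<in>{2..<l}. x i) > 0" by linarith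
    moreover have "(\<Sum>i\<in>{2..<l}. (\<mu> i)\<^sup>2) / 2 = (\<Sum>i\<in>{2..<l}. x i)"
      unfolding sum_divide_distrib using \<mu>x by (intro sum.cong) auto
    ultimately show ?thesis by simp
  qed
  have c2: "d i + (if i < l then (\<mu> i)\<^sup>2 / 2 else 0)
      - (if 2 < i then (\<mu> (i - 1))\<^sup>2 / 2 else 0) > 0" if i: "i \<in> {2..l}" for i
  proof -
    have up: "(if i < l then (\<mu> i)\<^sup>2 / 2 else 0) = x i"
      using i \<mu>x[of i] by (auto simp: x_def L_def)
    have di: "d i = b + (real i - 2) * a" using d[OF i] i by (simp add: of_nat_diff)
    show ?thesis
    proof (cases "2 < i")
      case True
      then have "i - 1 \<in> {2..<l}" using i by auto
      then have "(\<mu> (i - 1))\<^sup>2 / 2 = x (i - 1)" by (rule \<mu>x)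
      moreover have "d i + x i - x (i - 1) = \<delta>"
        using True by (simp add: di x_def g_def of_nat_diff field_simps)
      ultimately show ?thesis using True up \<delta> by simp
    next
      case False
      then have "i = 2" using i by simp
      moreover have "d 2 + x 2 = (L - 1) * g 1 - (L - 2) * \<delta>"
        using di \<open>i = 2\<close> by (simp add: x_def g_def field_simps)
      moreover have "(L - 2) * \<delta> < (L - 1) * g 1"
        using L \<delta> by (intro mult_strict_mono) auto
      ultimately show ?thesis using up by simp
    qed
  qed
  show "\<exists>\<mu>. (\<forall>i. \<mu> i > 0) \<and> a + (\<Sum>i\<in>{2..<l}. (\<mu> i)\<^sup>2) / 2 > 0 \<and>
      (\<forall>i\<in>{2..l}. d i + (if i < l then (\<mu> i)\<^sup>2 / 2 else 0)
                       - (if 2 < i then (\<mu> (i - 1))\<^sup>2 / 2 else 0) > 0)"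
    using \<mu> c1 c2 by blast
qed

section \<open>Brackets and derived ideals\<close>

lemma bracket_span_minimal:
  assumes "subspace S" "\<And>x y. x \<in> A \<Longrightarrow> y \<in> B \<Longrightarrow> br x y \<in> S"
  shows "bracket_span br A B \<subseteq> S"
  unfolding bracket_span_def using assms by (intro span_minimal) auto

lemma bracket_span_base: "x \<in> A \<Longrightarrow> y \<in> B \<Longrightarrow> br x y \<in> bracket_span br A B"
  unfolding bracket_span_def by (intro span_base) blast

lemma subspace_bracket_span: "subspace (bracket_span br A B)"
  unfolding bracket_span_def by (rule subspace_span)

lemma lie_bracket_derivation:
  assumes "lie_bracket br"
  shows "br z (br x y) = br (br z x) y + br x (br z y)"
proof -
  have bil: "bilinear br" and jacobi: "br z (br x y) + br x (br y z) + br y (br z x) = 0"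
    using assms by (auto simp: lie_bracket_def)
  have 1: "br y (br z x) = - br (br z x) y" by (rule lie_bracket_skew[OF assms])
  have 2: "br x (br y z) = - br x (br z y)"
    by (subst lie_bracket_skew[OF assms, of y z]) (rule bilinear_rneg[OF bil])
  have "br z (br x y) - (br (br z x) y + br x (br z y)) = 0"
    using jacobi unfolding 1 2 by (simp add: algebra_simps)
  then show ?thesis by (rule eq_iff_diff_eq_0[THEN iffD2])
qed

lemma lie_ideal_derived_series:
  assumes br: "lie_bracket br"
  shows "lie_ideal br (derived_series br UNIV k)"
proof (induction k)
  case 0
  show ?case by (simp add: lie_ideal_def)
next
  case (Suc k)
  define D where "D = derived_series br UNIV k"
  define S where "S = bracket_span br D D"
  have bil: "bilinear br" using br by (simp add: lie_bracket_def)
  have D: "\<And>x y. y \<in> D \<Longrightarrow> br x y \<in> D" using Suc by (auto simp: lie_ideal_def D_def)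
  have sub: "subspace S" unfolding S_def by (rule subspace_bracket_span)
  have "br z v \<in> S" if "v \<in> S" for z v
  proof -
    have "subspace {v. br z v \<in> S}"
      using linear_subspace_vimage[of "br z" S] bil sub by (simp add: bilinear_def vimage_def)
    moreover have "br z (br x y) \<in> S" if "x \<in> D" "y \<in> D" for x y
      unfolding lie_bracket_derivation[OF br, of z x y]
      using that D by (intro subspace_add[OF sub]) (auto simp: S_def intro!: bracket_span_base)
    ultimately have "S \<subseteq> {v. br z v \<in> S}"
      using bracket_span_minimal[of "{v. br z v \<in> S}" D D br] unfolding S_def by blast
    then show ?thesis using that by blast
  qed
  then show ?case using sub by (simp add: lie_ideal_def S_def D_def)
qed

section \<open>Weights on a filiform nilradical\<close>

locale filiform_nilradical =
  fixes br :: "'a::real_vector \<Rightarrow> 'a \<Rightarrow> 'a" and N :: "'a set" and X :: "nat \<Rightarrow> 'a" and l :: nat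
  assumes l: "4 \<le> l"
    and finite_dim: "\<exists>B :: 'a set. finite B \<and> span B = UNIV"
    and lie: "lie_bracket br"
    and solvable: "lie_solvable br UNIV"
    and nilradical: "is_nilradical br N"
    and filiform: "standard_filiform_basis br N l X"
begin

lemma bil: "bilinear br" using lie by (simp add: lie_bracket_def)

lemma skew: "br x y = - br y x" by (rule lie_bracket_skew[OF lie])

lemma linear_br: "linear (br x)" "linear (\<lambda>x. br x y)"
  using bil by (auto simp: bilinear_def)

lemma N_ideal: "subspace N" "y \<in> N \<Longrightarrow> br x y \<in> N" "x \<in> N \<Longrightarrow> br x y \<in> N"
proof -
  show N: "subspace N" and right: "y \<in> N \<Longrightarrow> br x y \<in> N" for x y
    using nilradical by (auto simp: is_nilradical_def lie_ideal_def)
  show "x \<in> N \<Longrightarrow> br x y \<in> N"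
    unfolding skew[of x y] by (intro subspace_neg[OF N] right)
qed

lemma X_basis: "inj_on X {1..l}" "independent (X ` {1..l})" "span (X ` {1..l}) = N"
  using filiform by (auto simp: standard_filiform_basis_def)

lemma X_in_N: "i \<in> {1..l} \<Longrightarrow> X i \<in> N"
  unfolding X_basis(3)[symmetric] by (intro span_base imageI)

text \<open>Linear forms on the whole algebra that restrict to the coordinates of the nilradical.\<close>

definition coord :: "nat \<Rightarrow> 'a \<Rightarrow> real" where
  "coord = (SOME \<phi>. (\<forall>i. linear (\<phi> i)) \<and>
     (\<forall>i\<in>{1..l}. \<forall>j\<in>{1..l}. \<phi> i (X j) = (if i = j then 1 else (0::real))))"

lemma linear_coord: "linear (coord i)"
  and coord_X: "i \<in> {1..l} \<Longrightarrow> j \<in> {1..l} \<Longrightarrow> coord i (X j) = (if i = j then 1 else 0)"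
proof -
  have "(\<forall>i. linear (coord i)) \<and>
     (\<forall>i\<in>{1..l}. \<forall>j\<in>{1..l}. coord i (X j) = (if i = j then 1 else (0::real)))"
    unfolding coord_def by (rule someI_ex[OF dual_family_exists[OF X_basis(1,2)]])
  note coord = this
  show "linear (coord i)" using conjunct1[OF coord] ..
  show "i \<in> {1..l} \<Longrightarrow> j \<in> {1..l} \<Longrightarrow> coord i (X j) = (if i = j then 1 else 0)"
    by (rule bspec[OF bspec[OF conjunct2[OF coord]]])
qed

lemma N_expansion:
  assumes "v \<in> N"
  shows "(\<Sum>i\<in>{1..l}. coord i v *\<^sub>R X i) = v"
proof (rule dual_family_expansion[where \<phi> = coord and e = X and I = "{1..l}"])
  show "v \<in> span (X ` {1..l})" using assms by (simp only: X_basis(3))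
qed (simp_all only: finite_atLeastAtMost linear_coord coord_X)

lemma coord_linear_N:
  assumes f: "linear f" and v: "v \<in> N"
  shows "coord k (f v) = (\<Sum>i\<in>{1..l}. coord i v * coord k (f (X i)))"
proof -
  have "linear (\<lambda>v. coord k (f v))"
    using linear_compose[OF f linear_coord[of k]] by (simp add: o_def)
  note lin = this
  have "coord k (f v) = coord k (f (\<Sum>i\<in>{1..l}. coord i v *\<^sub>R X i))" by (simp only: N_expansion[OF v])
  then show ?thesis by (simp add: linear_sum[OF lin] linear_scale[OF lin])
qed

text \<open>The ideals \<open>Span (X k, \<dots>, X l)\<close>; \<open>tail 2\<close> is the abelian ideal of codimension one and
  \<open>tail l\<close> the centre of the nilradical.\<close>

definition tail :: "nat \<Rightarrow> 'a set" where
  "tail k = span (X ` {k..l})"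

lemma tail_subset_N: "1 \<le> k \<Longrightarrow> tail k \<subseteq> N"
  unfolding tail_def X_basis(3)[symmetric] by (intro span_mono image_mono) auto

lemma tail_mono: "j \<le> k \<Longrightarrow> tail k \<subseteq> tail j"
  unfolding tail_def by (intro span_mono image_mono) auto

lemma mem_tail_iff:
  assumes "1 \<le> k"
  shows "v \<in> tail k \<longleftrightarrow> v \<in> N \<and> (\<forall>j\<in>{1..l}. j < k \<longrightarrow> coord j v = 0)"
proof
  assume v: "v \<in> tail k"
  have "coord j v = 0" if j: "j \<in> {1..l}" "j < k" for j
  proof -
    have "tail k \<subseteq> {v. coord j v = 0}"
      unfolding tail_def
    proof (rule span_minimal)
      show "X ` {k..l} \<subseteq> {v. coord j v = 0}" using j assms coord_X[of j] by fastforce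
    qed (rule linear_subspace_kernel[OF linear_coord])
    then show ?thesis using v by blast
  qed
  then show "v \<in> N \<and> (\<forall>j\<in>{1..l}. j < k \<longrightarrow> coord j v = 0)" using v tail_subset_N[OF assms] by blast
next
  assume v: "v \<in> N \<and> (\<forall>j\<in>{1..l}. j < k \<longrightarrow> coord j v = 0)"
  have "(\<Sum>i\<in>{1..l}. coord i v *\<^sub>R X i) \<in> tail k"
    unfolding tail_def
  proof (rule span_sum)
    fix i assume i: "i \<in> {1..l}"
    show "coord i v *\<^sub>R X i \<in> span (X ` {k..l})"
    proof (cases "i < k")
      case True
      then show ?thesis using v i by (simp add: span_zero)
    next
      case False
      then show ?thesis using i by (intro span_scale span_base) auto
    qed
  qed
  then show "v \<in> tail k" using N_expansion v by simp
qed

lemma br_X1: "i \<in> {2..<l} \<Longrightarrow> br (X 1) (X i) = X (Suc i)" "br (X 1) (X l) = 0"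
  and br_XX: "i \<in> {2..l} \<Longrightarrow> j \<in> {2..l} \<Longrightarrow> br (X i) (X j) = 0"
  using filiform by (auto simp: standard_filiform_basis_def)

lemma br_self: "br x x = 0" using lie by (simp add: lie_bracket_def)

lemma coord_br_X:
  assumes "i \<in> {1..l}" "j \<in> {1..l}" "k \<in> {1..l}"
  shows "coord k (br (X i) (X j)) =
    (if i = 1 \<and> j \<in> {2..<l} \<and> k = Suc j then 1
     else if j = 1 \<and> i \<in> {2..<l} \<and> k = Suc i then - 1 else 0)"
proof -
  have c0: "coord k 0 = 0" by (rule linear_0[OF linear_coord])
  have X1: "coord k (br (X 1) (X j)) = (if j \<in> {2..<l} \<and> k = Suc j then 1 else 0)"
    if "j \<in> {1..l}" for j
  proof -
    have "j = 1 \<or> j \<in> {2..<l} \<or> j = l" using that by auto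
    then show ?thesis
      using br_self br_X1 assms coord_X c0 by auto
  qed
  have "i = 1 \<or> i \<in> {2..l}" "j = 1 \<or> j \<in> {2..l}" using assms by auto
  then consider "i = 1" | "j = 1" "i \<noteq> 1" | "i \<in> {2..l}" "j \<in> {2..l}" by blast
  then show ?thesis
  proof cases
    case 2
    have "coord k (br (X i) (X 1)) = - coord k (br (X 1) (X i))"
      by (subst skew) (rule linear_neg[OF linear_coord])
    then show ?thesis using 2 X1[OF assms(1)] by auto
  qed (use X1[OF assms(2)] br_XX c0 in auto)
qed

lemma br_N_X:
  assumes v: "v \<in> N" and i: "i \<in> {2..l}"
  shows "br v (X i) = coord 1 v *\<^sub>R (if i < l then X (Suc i) else 0)"
proof -
  have "br v (X i) = br (\<Sum>j\<in>{1..l}. coord j v *\<^sub>R X j) (X i)" by (simp only: N_expansion[OF v])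
  also have "\<dots> = (\<Sum>j\<in>{1..l}. coord j v *\<^sub>R br (X j) (X i))"
    by (rule bilinear_sum_scale_left[OF bil])
  also have "\<dots> = (\<Sum>j\<in>{1..l}. if j = 1 then coord 1 v *\<^sub>R br (X 1) (X i) else 0)"
    using i by (intro sum.cong refl) (auto simp: br_XX)
  also have "\<dots> = coord 1 v *\<^sub>R br (X 1) (X i)" using l by simp
  finally show ?thesis using i br_X1 by (cases "i < l") auto
qed

lemma coord_br_X1_N:
  assumes v: "v \<in> N" and k: "k \<in> {1..l}"
  shows "coord k (br (X 1) v) = (if 3 \<le> k then coord (k - 1) v else 0)"
proof -
  have "coord k (br (X 1) v) = (\<Sum>i\<in>{1..l}. coord i v * coord k (br (X 1) (X i)))"
    by (rule coord_linear_N[OF linear_br(1) v])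
  also have "\<dots> = (\<Sum>i\<in>{1..l}. if i = k - 1 then (if 3 \<le> k then coord i v else 0) else 0)"
    using k l by (intro sum.cong refl) (auto simp: coord_br_X)
  finally show ?thesis using k by auto
qed

text \<open>Applying the derivation \<open>ad Y\<close> to \<open>[X i, X j] = 0\<close> gives \<open>\<alpha> i X (j + 1) = \<alpha> j X (i + 1)\<close> with \<open>\<alpha> i\<close> the
  first coordinate of \<open>[Y, X i]\<close>. For some \<open>j \<noteq> i\<close> with \<open>2 \<le> j < l\<close>, available as \<open>l \<ge> 4\<close>, the coordinate
  \<open>j + 1\<close> of this equation isolates \<open>\<alpha> i\<close>.\<close>

lemma coord_1_br_X:
  assumes i: "i \<in> {2..l}"
  shows "coord 1 (br Y (X i)) = 0"
proof -
  define j where "j = (if i = 2 then 3 else 2 :: nat)"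
  have j: "j \<in> {2..<l}" "j \<noteq> i" using l by (auto simp: j_def)
  have N: "br Y (X i) \<in> N" "br Y (X j) \<in> N" using i j by (auto intro!: N_ideal(2) X_in_N)
  have "0 = br Y (br (X i) (X j))" using br_XX[OF i] j by (simp add: bilinear_rzero[OF bil])
  also have "\<dots> = br (br Y (X i)) (X j) - br (br Y (X j)) (X i)"
    unfolding lie_bracket_derivation[OF lie, of Y "X i" "X j"]
    by (subst skew[of "X i" "br Y (X j)"]) simp
  also have "\<dots> = coord 1 (br Y (X i)) *\<^sub>R X (Suc j)
      - coord 1 (br Y (X j)) *\<^sub>R (if i < l then X (Suc i) else 0)"
    using br_N_X[OF N(1), of j] br_N_X[OF N(2) i] j by simp
  finally have "coord (Suc j) 0 = coord (Suc j) \<dots>" by (rule arg_cong)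
  also have "\<dots> = coord 1 (br Y (X i))"
    using i j by (simp add: linear_diff[OF linear_coord] linear_scale[OF linear_coord] coord_X
        linear_0[OF linear_coord])
  finally show ?thesis by (simp add: linear_0[OF linear_coord])
qed

definition weight :: "nat \<Rightarrow> 'a \<Rightarrow> real" where
  "weight i Y = coord i (br Y (X i))"

lemma linear_weight: "linear (weight i)"
  using linear_compose[OF linear_br(2)[of "X i"] linear_coord[of i]]
  unfolding weight_def[abs_def] by (simp add: o_def)

text \<open>The derivation rule for \<open>[X 1, X i] = X (i + 1)\<close>: a recursion that yields both triangularity and the
  arithmetic progression of the weights.\<close>

lemma coord_br_X_Suc:
  assumes i: "i \<in> {2..<l}" and k: "k \<in> {1..l}"
  shows "coord k (br Y (X (Suc i))) =
    (if k = Suc i then weight 1 Y else 0) + (if 3 \<le> k then coord (k - 1) (br Y (X i)) else 0)"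
proof -
  have N: "br Y (X i) \<in> N" "br Y (X 1) \<in> N" using i by (auto intro!: N_ideal(2) X_in_N)
  have "br Y (X (Suc i)) = br Y (br (X 1) (X i))" using br_X1(1)[OF i] by simp
  also have "\<dots> = br (br Y (X 1)) (X i) + br (X 1) (br Y (X i))"
    by (rule lie_bracket_derivation[OF lie])
  also have "\<dots> = weight 1 Y *\<^sub>R X (Suc i) + br (X 1) (br Y (X i))"
    using br_N_X[OF N(2), of i] i by (simp add: weight_def)
  finally show ?thesis
    using i k by (simp add: linear_add[OF linear_coord] linear_scale[OF linear_coord] coord_X
        coord_br_X1_N[OF N(1) k] del: One_nat_def)
qed

lemma br_X_triangular:
  assumes "i \<in> {1..l}" "k \<in> {1..l}" "k < i"
  shows "coord k (br Y (X i)) = 0"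
proof -
  have "2 \<le> i" using assms by auto
  then have "\<forall>k\<in>{1..l}. i \<le> l \<longrightarrow> k < i \<longrightarrow> coord k (br Y (X i)) = 0"
  proof (induction i rule: dec_induct)
    case base
    show ?case using coord_1_br_X[of 2 Y] l by (auto simp: less_2_cases_iff)
  next
    case (step i)
    show ?case
    proof (intro ballI impI)
      fix k assume k: "k \<in> {1..l}" "Suc i \<le> l" "k < Suc i"
      have "coord (k - 1) (br Y (X i)) = 0" if "3 \<le> k"
        using step.IH[rule_format, of "k - 1"] k that by auto
      then show "coord k (br Y (X (Suc i))) = 0"
        using coord_br_X_Suc[of i k Y] step.hyps k by auto
    qed
  qed
  then show ?thesis using assms by auto
qed

lemma weight_arithmetic:
  assumes "i \<in> {2..l}"
  shows "weight i Y = weight 2 Y + real (i - 2) * weight 1 Y"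
proof -
  have "2 \<le> i" using assms by auto
  then have "i \<le> l \<longrightarrow> weight i Y = weight 2 Y + real (i - 2) * weight 1 Y"
  proof (induction i rule: dec_induct)
    case (step i)
    have "weight (Suc i) Y = weight 1 Y + weight i Y" if "Suc i \<le> l"
      using coord_br_X_Suc[of i "Suc i" Y] step.hyps that by (simp add: weight_def)
    then show ?case using step by (auto simp: Suc_diff_le algebra_simps)
  qed simp
  then show ?thesis using assms by simp
qed

lemma br_X_mem_tail: "i \<in> {1..l} \<Longrightarrow> br Y (X i) \<in> tail i"
  by (subst mem_tail_iff) (auto intro!: N_ideal(2) X_in_N br_X_triangular)

lemma lie_ideal_tail:
  assumes "1 \<le> k"
  shows "lie_ideal br (tail k)"
  unfolding lie_ideal_def
proof (intro conjI allI ballI)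
  show "subspace (tail k)" by (simp add: tail_def)
  fix Y v assume "v \<in> tail k"
  moreover have "tail k \<subseteq> {v. br Y v \<in> tail k}"
    unfolding tail_def[of k]
  proof (intro span_minimal)
    show "subspace {v. br Y v \<in> span (X ` {k..l})}"
      using linear_subspace_vimage[OF linear_br(1)[of Y] subspace_span] by (simp add: vimage_def)
    show "X ` {k..l} \<subseteq> {v. br Y v \<in> span (X ` {k..l})}"
    proof (intro image_subsetI CollectI)
      fix i assume i: "i \<in> {k..l}"
      then have "br Y (X i) \<in> tail i" using assms by (intro br_X_mem_tail) auto
      then show "br Y (X i) \<in> span (X ` {k..l})" using tail_mono[of k i] i by (auto simp: tail_def)
    qed
  qed
  ultimately show "br Y v \<in> tail k" by blast
qed

lemma coord_br_tail:
  assumes i: "i \<in> {1..l}" and v: "v \<in> tail i"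
  shows "coord i (br Y v) = weight i Y * coord i v"
proof -
  have vN: "v \<in> N" and v0: "\<And>j. j \<in> {1..l} \<Longrightarrow> j < i \<Longrightarrow> coord j v = 0"
    using v i by (auto simp: mem_tail_iff)
  have "coord i (br Y v) = (\<Sum>j\<in>{1..l}. coord j v * coord i (br Y (X j)))"
    by (rule coord_linear_N[OF linear_br(1) vN])
  also have "\<dots> = (\<Sum>j\<in>{1..l}. if j = i then coord i v * weight i Y else 0)"
  proof (intro sum.cong refl)
    fix j assume j: "j \<in> {1..l}"
    show "coord j v * coord i (br Y (X j)) = (if j = i then coord i v * weight i Y else 0)"
      using v0[OF j] br_X_triangular[OF j i] by (cases j i rule: linorder_cases) (auto simp: weight_def)
  qed
  finally show ?thesis using i by simp
qed

text \<open>The weights are the characters by which the algebra acts on the one-dimensional quotients of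
  successive tails, and characters vanish on brackets.\<close>

lemma weight_bracket:
  assumes i: "i \<in> {1..l}"
  shows "weight i (br Y Z) = 0"
proof -
  have "br (br Y Z) (X i) = br Y (br Z (X i)) - br Z (br Y (X i))"
    using lie_bracket_derivation[OF lie, of Y Z "X i"] by simp
  then have "weight i (br Y Z) = coord i (br Y (br Z (X i))) - coord i (br Z (br Y (X i)))"
    by (simp add: weight_def linear_diff[OF linear_coord])
  then show ?thesis using coord_br_tail[OF i br_X_mem_tail[OF i]] by (simp add: weight_def)
qed

lemma weight_N:
  assumes i: "i \<in> {1..l}" and v: "v \<in> N"
  shows "weight i v = 0"
proof -
  have "X ` {1..l} \<subseteq> {v. weight i v = 0}"
    using i by (auto simp: weight_def coord_br_X)
  then have "N \<subseteq> {v. weight i v = 0}"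
    unfolding X_basis(3)[symmetric] by (intro span_minimal linear_subspace_kernel linear_weight)
  then show ?thesis using v by blast
qed

lemma br_tail_Suc:
  assumes Y: "\<And>i. i \<in> {1..l} \<Longrightarrow> weight i Y = 0" and k: "1 \<le> k" and v: "v \<in> tail k"
  shows "br Y v \<in> tail (Suc k)"
proof -
  have bN: "br Y v \<in> N" and bk: "br Y v \<in> tail k"
    using v lie_ideal_tail[OF k] tail_subset_N[OF k] by (auto simp: lie_ideal_def)
  have "coord j (br Y v) = 0" if "j \<in> {1..l}" "j < Suc k" for j
  proof (cases "j = k")
    case True
    then show ?thesis using coord_br_tail[of k v Y] v that Y by simp
  next
    case False
    then show ?thesis using bk k that by (simp add: mem_tail_iff)
  qed
  then show ?thesis using bN by (simp add: mem_tail_iff)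
qed

text \<open>Elements with vanishing weights form an ideal \<open>K\<close> that contains all brackets and acts nilpotently on
  the nilradical. Descending induction along the derived series \<open>D\<close> shows \<open>D k \<inter> K \<subseteq> N\<close>: if this
  holds for \<open>k + 1\<close>, then \<open>M = (D k \<inter> K) + N\<close> is an ideal with \<open>[M, M] \<subseteq> N\<close>, and bracketing with
  \<open>M \<subseteq> K\<close> moves the tails strictly down, so that \<open>M\<close> is nilpotent and hence equal to \<open>N\<close>. Solvability
  starts the induction; Lie's theorem is avoided.\<close>

lemma weights_zero_imp_N:
  assumes "\<And>i. i \<in> {1..l} \<Longrightarrow> weight i Y = 0"
  shows "Y \<in> N"
proof -
  define K where "K = {Y. \<forall>i\<in>{1..l}. weight i Y = 0}"
  have subK: "subspace K"
    using linear_weight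
    by (auto simp: K_def subspace_def linear_0 linear_add linear_scale)
  have brK: "br Y Z \<in> K" for Y Z using weight_bracket by (auto simp: K_def)
  have NK: "N \<subseteq> K" using weight_N by (auto simp: K_def)
  define D where "D = derived_series br UNIV"
  have D: "subspace (D k)" "\<And>x y. y \<in> D k \<Longrightarrow> br x y \<in> D k" for k
    using lie_ideal_derived_series[OF lie, of k] by (auto simp: lie_ideal_def D_def)
  obtain n where n: "D n = {0}" using solvable by (auto simp: lie_solvable_def D_def)
  have "D 0 \<inter> K \<subseteq> N"
  proof (rule inc_induct[of 0 n])
    show "D n \<inter> K \<subseteq> N" using n subspace_0[OF N_ideal(1)] by auto
  next
    fix k assume IH: "D (Suc k) \<inter> K \<subseteq> N"
    define M where "M = {u + v | u v. u \<in> D k \<inter> K \<and> v \<in> N}"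
    have subM: "subspace M"
      unfolding M_def by (intro subspace_sums subspace_inter D(1) subK N_ideal(1))
    have sub: "D k \<inter> K \<subseteq> M" "N \<subseteq> M"
      unfolding M_def using subspace_0[OF N_ideal(1)] subspace_0[OF D(1)] subspace_0[OF subK]
      by (force, force)
    have MK: "M \<subseteq> K" unfolding M_def using subspace_add[OF subK] NK by auto
    have "br x y \<in> M" if y: "y \<in> M" for x y
    proof -
      obtain u v where uv: "y = u + v" "u \<in> D k \<inter> K" "v \<in> N" using y unfolding M_def by blast
      have "br x u \<in> D k \<inter> K" using D(2) brK uv by auto
      moreover have "br x v \<in> N" using uv N_ideal by blast
      ultimately show ?thesis unfolding uv(1) bilinear_radd[OF bil] M_def by blast
    qed
    then have idM: "lie_ideal br M" using subM by (simp add: lie_ideal_def)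
    have MM: "br x y \<in> N" if xy: "x \<in> M" "y \<in> M" for x y
    proof -
      obtain u v where uv: "x = u + v" "u \<in> D k \<inter> K" "v \<in> N" using xy(1) unfolding M_def by blast
      obtain u' v' where uv': "y = u' + v'" "u' \<in> D k \<inter> K" "v' \<in> N" using xy(2) unfolding M_def by blast
      have "br u u' \<in> D (Suc k)"
        using uv uv' by (simp add: D_def bracket_span_base)
      then have "br u u' \<in> N" using IH brK by blast
      moreover have "br x y = br u u' + (br u v' + br v y)"
        by (simp add: uv(1) uv'(1) bilinear_ladd[OF bil] bilinear_radd[OF bil] add.assoc)
      moreover have "br u v' \<in> N" "br v y \<in> N" using uv uv' N_ideal by blast+
      ultimately show ?thesis by (simp add: subspace_add[OF N_ideal(1)])
    qed
    have low: "lower_central_series br M (Suc j) \<subseteq> tail (Suc j)" for j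
    proof (induction j)
      case 0
      have "bracket_span br M M \<subseteq> N"
        by (rule bracket_span_minimal[OF N_ideal(1)]) (rule MM)
      then show ?case by (simp add: tail_def X_basis(3)[simplified One_nat_def])
    next
      case (Suc j)
      have "br x y \<in> tail (Suc (Suc j))" if "x \<in> M" "y \<in> tail (Suc j)" for x y
        using that MK by (intro br_tail_Suc) (auto simp: K_def)
      moreover have "subspace (tail (Suc (Suc j)))" by (simp add: tail_def)
      ultimately show ?case
        using Suc unfolding lower_central_series.simps(2)[of br M "Suc j"]
        by (intro bracket_span_minimal) auto
    qed
    have "lower_central_series br M (Suc l) \<subseteq> {0}"
      using low[of l] by (simp add: tail_def)
    moreover have "0 \<in> lower_central_series br M (Suc l)"
      using subspace_0[OF subspace_bracket_span] by simp
    ultimately have "lower_central_series br M (Suc l) = {0}" by blast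
    then have "lie_nilpotent br M" unfolding lie_nilpotent_def by blast
    then have "M = N" using nilradical idM sub(2) unfolding is_nilradical_def by blast
    then show "D k \<inter> K \<subseteq> N" using sub(1) by blast
  qed simp
  then show ?thesis using assms by (auto simp: D_def K_def)
qed

lemma centre_weight_eq: "centre_weight br l X Y = weight l Y"
proof -
  have ll: "l \<in> {1..l}" using l by simp
  have "br Y (X l) \<in> tail l" by (rule br_X_mem_tail[OF ll])
  then obtain c where c: "br Y (X l) = c *\<^sub>R X l"
    by (auto simp: tail_def span_singleton)
  then have "weight l Y = c"
    using ll by (simp add: weight_def linear_scale[OF linear_coord] coord_X)
  moreover have "X l \<noteq> 0" using coord_X[OF ll ll] linear_0[OF linear_coord] by force
  ultimately show ?thesis unfolding centre_weight_def c by (intro the_equality) auto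
qed

lemma trace_on_tail:
  assumes "1 \<le> k"
  shows "trace_on (tail k) (br Y) = (\<Sum>i\<in>{k..l}. weight i Y)"
  unfolding tail_def weight_def
proof (rule trace_on_dual_family)
  show "coord i (X j) = (if i = j then 1 else 0)" if "i \<in> {k..l}" "j \<in> {k..l}" for i j
    using that assms by (intro coord_X) auto
  show "br Y v \<in> span (X ` {k..l})" if "v \<in> span (X ` {k..l})" for v
    using lie_ideal_tail[OF assms] that by (simp add: lie_ideal_def tail_def)
qed (use linear_coord linear_br in auto)

lemma ideal_trace_eq: "ideal_trace br l X Y = (\<Sum>i\<in>{2..l}. weight i Y)"
  unfolding ideal_trace_def using trace_on_tail[of 2 Y] by (simp add: tail_def)

lemma br_tail_2:
  assumes "x \<in> tail 2" "y \<in> tail 2"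
  shows "br x y = 0"
proof -
  have "subspace {y. br x y = 0}" for x by (rule linear_subspace_kernel[OF linear_br(1)])
  then have 1: "tail 2 \<subseteq> {y. br (X i) y = 0}" if "i \<in> {2..l}" for i
    unfolding tail_def using br_XX[OF that] by (intro span_minimal) auto
  have "subspace {x. br x y = 0}" by (rule linear_subspace_kernel[OF linear_br(2)])
  then have "tail 2 \<subseteq> {x. br x y = 0}"
    unfolding tail_def[of 2] using 1 assms(2) by (intro span_minimal) blast+
  then show ?thesis using assms(1) by blast
qed

section \<open>Existence of negatively curved inner products\<close>

text \<open>Both \<open>tail l\<close> and \<open>tail 2\<close> are abelian ideals, with traces \<open>\<lambda>\<close> and \<open>\<iota>\<close>, and the same \<open>H\<close> is tested
  on both.\<close>

lemma negative_ricci_necessary: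
  assumes "inner_product ip" "negative_ricci br ip"
  shows "\<exists>Y. centre_weight br l X Y > 0 \<and> ideal_trace br l X Y > 0"
proof -
  obtain B :: "'a set" where B: "finite B" "span B = UNIV" using finite_dim by blast
  have pos: "(\<Sum>i\<in>{k..l}. weight i (trace_vector br ip)) > 0" if k: "2 \<le> k" "k \<le> l" for k
  proof -
    have "X k \<in> tail k" unfolding tail_def using k by (intro span_base) auto
    moreover have "X k \<noteq> 0" using coord_X[of k k] linear_0[OF linear_coord] k by force
    ultimately have "tail k \<noteq> {0}" by blast
    moreover have "br x y = 0" if "x \<in> tail k" "y \<in> tail k" for x y
      using that br_tail_2 tail_mono[OF k(1)] by blast
    ultimately have "trace_on (tail k) (br (trace_vector br ip)) > 0"
      using k by (intro negative_ricci_abelian_ideal[OF B lie assms] lie_ideal_tail) auto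
    then show ?thesis using k by (simp add: trace_on_tail)
  qed
  show ?thesis
    using pos[of l] pos[of 2] l unfolding centre_weight_eq ideal_trace_eq by auto
qed

text \<open>The normalisation of the trace of \<open>ad Y\<close> makes \<open>Y\<close> the mean curvature vector of the graded model.
  Degrees are \<open>i\<close> on \<open>X i\<close> and \<open>0\<close> on the complement; the products \<open>m\<close> of the \<open>\<mu> j\<close> are chosen so that the rescaled
  bracket \<open>[X 1, X i]\<close> acquires the coefficient \<open>m (i + 1) / (m 1 * m i) = \<mu> i\<close>.\<close>

lemma negative_ricci_sufficient:
  assumes centre: "weight l Y > 0" and ideal: "(\<Sum>i\<in>{2..l}. weight i Y) > 0"
    and normalised: "(\<Sum>i\<in>{1..l}. weight i Y) = 1"
  shows "\<exists>ip. inner_product ip \<and> negative_ricci br ip"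
proof -
  define \<tau> where "\<tau> v = (\<Sum>i\<in>{1..l}. weight i v)" for v
  have \<tau>: "linear \<tau>" unfolding \<tau>_def by (rule linear_compose_sum) (simp add: linear_weight)
  have \<tau>X: "\<tau> (X i) = 0" if "i \<in> {1..l}" for i
    using weight_N X_in_N[OF that] by (simp add: \<tau>_def)
  have \<tau>Y: "\<tau> Y = 1" unfolding \<tau>_def by (rule normalised)
  obtain n e where n: "l < n" and e: "inj_on e {1..n}" "independent (e ` {1..n})"
    "span (e ` {1..n}) = UNIV" and eX: "\<And>i. i \<in> {1..l} \<Longrightarrow> e i = X i" and en: "e n = Y"
    and \<tau>e: "\<And>h. h \<in> {Suc l..n} \<Longrightarrow> \<tau> (e h) = (if h = n then 1 else 0)"
    using basis_adapted_to_functional[OF finite_dim X_basis(1,2) \<tau> \<tau>X \<tau>Y] by blast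
  define K where "K = {Suc l..n}"
  have K: "finite K" "K \<inter> {1..l} = {}" "n \<in> K" using n by (auto simp: K_def)
  have I: "{1..n} = {1..l} \<union> K" using n by (auto simp: K_def)
  obtain \<psi> where \<psi>: "\<And>i. linear (\<psi> i)"
    "\<And>i j. i \<in> {1..n} \<Longrightarrow> j \<in> {1..n} \<Longrightarrow> \<psi> i (e j) = (if i = j then 1 else (0::real))"
    using dual_family_exists[OF e(1,2)] by blast
  have \<psi>N: "\<psi> k v = (if k \<in> {1..l} then coord k v else 0)" if v: "v \<in> N" and k: "k \<in> {1..n}" for k v
  proof -
    have "\<psi> k v = \<psi> k (\<Sum>i\<in>{1..l}. coord i v *\<^sub>R X i)" by (simp only: N_expansion[OF v])
    also have "\<dots> = (\<Sum>i\<in>{1..l}. coord i v * \<psi> k (X i))"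
      by (simp add: linear_sum[OF \<psi>(1)] linear_scale[OF \<psi>(1)])
    also have "\<dots> = (\<Sum>i\<in>{1..l}. if i = k then coord i v else 0)"
    proof (intro sum.cong refl)
      fix i assume i: "i \<in> {1..l}"
      then have "i \<in> {1..n}" using n by auto
      then show "coord i v * \<psi> k (X i) = (if i = k then coord i v else 0)"
        using \<psi>(2)[OF k, of i] eX[OF i] by auto
    qed
    finally show ?thesis by simp
  qed
  have brN: "br u v \<in> N" for u v
    by (rule weights_zero_imp_N) (rule weight_bracket)
  define d where "d i h = weight i (e h)" for i h
  have dN: "d i n = weight i Y" for i by (simp add: d_def en)
  obtain \<mu> where \<mu>: "\<And>i. \<mu> i > 0"
    and \<mu>1: "weight 1 Y + (\<Sum>i\<in>{2..<l}. (\<mu> i)\<^sup>2) / 2 > 0"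
    and \<mu>2: "\<And>i. i \<in> {2..l} \<Longrightarrow> weight i Y + (if i < l then (\<mu> i)\<^sup>2 / 2 else 0)
                       - (if 2 < i then (\<mu> (i - 1))\<^sup>2 / 2 else 0) > 0"
    using filiform_weights_feasible(2)[OF l, of "\<lambda>i. weight i Y", OF weight_arithmetic centre ideal]
    by blast
  have tr: "(\<Sum>i\<in>{1..l}. d i h) = (if h = n then 1 else 0)" if "h \<in> K" for h
    using \<tau>e that by (simp add: \<tau>_def d_def K_def)
  \<comment> \<open>a combination of the complement with vanishing weights lies in the nilradical, hence is zero\<close>
  have faithful: "x h = 0" if x: "\<And>i. i \<in> {1..l} \<Longrightarrow> (\<Sum>h\<in>K. x h * d i h) = 0" and h: "h \<in> K" for x h
  proof -
    define v where "v = (\<Sum>h\<in>K. x h *\<^sub>R e h)"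
    have "weight i v = 0" if "i \<in> {1..l}" for i
      using x[OF that] by (simp add: v_def linear_sum[OF linear_weight] linear_scale[OF linear_weight] d_def)
    then have "v \<in> N" by (rule weights_zero_imp_N)
    then have "\<psi> h v = 0" using \<psi>N[of v h] h by (auto simp: K_def)
    moreover have "\<psi> h v = (\<Sum>j\<in>K. x j * \<psi> h (e j))"
      by (simp add: v_def linear_sum[OF \<psi>(1)] linear_scale[OF \<psi>(1)])
    moreover have "\<dots> = (\<Sum>j\<in>K. if j = h then x j else 0)"
      using \<psi>(2) h by (intro sum.cong refl) (auto simp: K_def)
    ultimately show ?thesis using h K(1) by simp
  qed
  have pos1: "d 1 n + (\<Sum>i\<in>{2..<l}. (\<mu> i)\<^sup>2) / 2 > 0" using \<mu>1 dN by simp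
  have pos: "d i n + (if i < l then (\<mu> i)\<^sup>2 / 2 else 0)
      - (if 2 < i then (\<mu> (i - 1))\<^sup>2 / 2 else 0) > 0" if "i \<in> {2..l}" for i
    using \<mu>2[OF that] dN by simp
  have neg: "negative_form ({1..l} \<union> K) (filiform_constants l K d \<mu>)"
  proof (rule negative_form_filiform_constants[where ?h0.0 = n])
    show "x h = 0" if "\<And>i. i \<in> {1..l} \<Longrightarrow> (\<Sum>h\<in>K. x h * d i h) = 0" "h \<in> K" for x h
      by (rule faithful[OF that])
  qed (use l in simp, (fact K tr pos1 pos)+)
  define w where "w i = (if i \<le> l then i else 0)" for i :: nat
  define m where "m i = (if i \<le> l then \<Prod>j\<in>{2..<i}. \<mu> j else 1)" for i
  have m: "m i > 0" for i using \<mu> by (simp add: m_def prod_pos)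
  have m1: "m 1 = 1" using l by (simp add: m_def)
  have mSuc: "m (Suc i) = m i * \<mu> i" if "i \<in> {2..<l}" for i
    using that by (simp add: m_def prod.atLeastLessThan_Suc)
  have wJ: "w i = i" if "i \<in> {1..l}" for i using that by (simp add: w_def)
  have wK: "w i = 0" if "i \<in> K" for i using that by (simp add: w_def K_def)
  have JK: "j \<notin> K" if "j \<in> {1..l}" for j using that by (simp add: K_def)
  have \<psi>br: "\<psi> k (br (e i) (e j)) = (if k \<in> {1..l} then coord k (br (e i) (e j)) else 0)"
    if "k \<in> {1..n}" for i j k
    by (rule \<psi>N[OF brN that])
  have KJ_less: "coord k (br (e i) (e j)) = 0" if "j \<in> {1..l}" "k \<in> {1..l}" "k < j" for i j k
    using br_X_triangular[OF that, of "e i"] by (simp only: eX[OF that(1)])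
  have KJ_eq: "coord k (br (e i) (e k)) = d k i" if "k \<in> {1..l}" for i k
    by (simp only: eX[OF that] d_def weight_def)
  have swap: "coord k (br (e i) (e j)) = - coord k (br (e j) (e i))" for i j k
    by (subst skew) (rule linear_neg[OF linear_coord])
  have JJ: "coord k (br (e i) (e j)) = (if i = 1 \<and> j \<in> {2..<l} \<and> k = Suc j then 1
     else if j = 1 \<and> i \<in> {2..<l} \<and> k = Suc i then - 1 else 0)"
    if "i \<in> {1..l}" "j \<in> {1..l}" "k \<in> {1..l}" for i j k
    using that coord_br_X[OF that] by (simp only: eX)
  have filt: "\<psi> k (br (e i) (e j)) = 0"
    if ijk: "i \<in> {1..n}" "j \<in> {1..n}" "k \<in> {1..n}" and less: "w k < w i + w j" for i j k
  proof (cases "k \<in> {1..l}")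
    case True
    consider "i \<in> K" "j \<in> K" | "i \<in> K" "j \<in> {1..l}" | "i \<in> {1..l}" "j \<in> K"
      | "i \<in> {1..l}" "j \<in> {1..l}" using ijk(1,2) unfolding I by blast
    then have "coord k (br (e i) (e j)) = 0"
    proof cases
      case 1
      then show ?thesis using less by (simp add: wK)
    next
      case 2
      then show ?thesis using less KJ_less[OF 2(2) True] by (simp add: wK wJ[OF True] wJ)
    next
      case 3
      then show ?thesis using less KJ_less[OF 3(1) True, of j] swap[of k i j] by (simp add: wK wJ[OF True] wJ)
    next
      case 4
      then show ?thesis using less JJ[OF 4 True] True by (auto simp: wJ)
    qed
    then show ?thesis by (simp add: \<psi>br[OF ijk(3)])
  qed (auto simp: \<psi>br[OF ijk(3)])
  have graded: "(if w k = w i + w j then m k / (m i * m j) * \<psi> k (br (e i) (e j)) else 0)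
      = filiform_constants l K d \<mu> i j k"
    if ijk: "i \<in> {1..l} \<union> K" "j \<in> {1..l} \<union> K" "k \<in> {1..l} \<union> K" for i j k
  proof (cases "k \<in> {1..l}")
    case True
    have kn: "k \<in> {1..n}" using True n by auto
    have mk: "m k \<noteq> 0" for k using m[of k] by simp
    have mK: "m i = 1" if "i \<in> K" for i using that by (simp add: m_def K_def)
    have \<psi>k: "\<psi> k (br (e i) (e j)) = coord k (br (e i) (e j))" for i j using \<psi>br[OF kn] True by simp
    have k0: "k \<noteq> 0" using True by auto
    consider "i \<in> K" "j \<in> K" | "i \<in> K" "j \<in> {1..l}" | "i \<in> {1..l}" "j \<in> K"
      | "i \<in> {1..l}" "j \<in> {1..l}" using ijk(1,2) by blast
    then show ?thesis
    proof cases
      case 1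
      then have "i \<noteq> 1" "j \<noteq> 1" "i \<noteq> k" "j \<noteq> k" using True JK l by auto
      then show ?thesis using 1 k0 True by (simp add: wK wJ filiform_constants_def)
    next
      case 2
      then have "i \<noteq> 1" "i \<notin> {2..<l}" "j \<notin> K" "i \<noteq> k" using True JK l by auto
      then show ?thesis using 2 True KJ_eq[OF True, of i] mk[of k]
        by (auto simp: wK wJ filiform_constants_def \<psi>k mK)
    next
      case 3
      then have "j \<noteq> 1" "j \<notin> {2..<l}" "i \<notin> K" "j \<noteq> k" using True JK l by auto
      then show ?thesis using 3 True KJ_eq[OF True, of j] swap[of k k j] mk[of k]
        by (auto simp: wK wJ filiform_constants_def \<psi>k mK)
    next
      case 4
      then have "i \<notin> K" "j \<notin> K" using JK by auto
      then show ?thesis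
        unfolding \<psi>k JJ[OF 4 True]
        using 4 True mSuc[of i] mSuc[of j] m1 mk[of i] mk[of j]
        by (auto simp: wJ filiform_constants_def simp del: One_nat_def)
    qed
  next
    case False
    then have "k \<in> {1..n}" using ijk(3) I by auto
    then show ?thesis using False by (auto simp: \<psi>br filiform_constants_def)
  qed
  have "negative_form {1..n} (\<lambda>i j k. if w k = w i + w j
      then m k / (m i * m j) * \<psi> k (br (e i) (e j)) else 0)
    = negative_form {1..n} (filiform_constants l K d \<mu>)"
    unfolding I by (rule negative_form_cong) (rule graded)
  then have limit: "negative_form {1..n} (\<lambda>i j k. if w k = w i + w j
      then m k / (m i * m j) * \<psi> k (br (e i) (e j)) else 0)"
    using neg by (simp only: I)
  show ?thesis
  proof (rule negative_ricci_degeneration[where I = "{1..n}" and \<phi> = \<psi> and e = e and m = m and w = w])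
    show "\<psi> k (br (e i) (e j)) = 0"
      if "i \<in> {1..n}" "j \<in> {1..n}" "k \<in> {1..n}" "w k < w i + w j" for i j k
      by (rule filt[OF that])
    show "\<psi> i (e j) = (if i = j then 1 else 0)" if "i \<in> {1..n}" "j \<in> {1..n}" for i j
      by (rule \<psi>(2)[OF that])
  qed (rule bil finite_atLeastAtMost \<psi>(1) e(3) m limit)+
qed

theorem negative_ricci_iff:
  "(\<exists>ip. inner_product ip \<and> negative_ricci br ip) \<longleftrightarrow>
   (\<exists>Y. centre_weight br l X Y > 0 \<and> ideal_trace br l X Y > 0)"
proof
  assume "\<exists>ip. inner_product ip \<and> negative_ricci br ip"
  then show "\<exists>Y. centre_weight br l X Y > 0 \<and> ideal_trace br l X Y > 0"
    using negative_ricci_necessary by blast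
next
  assume "\<exists>Y. centre_weight br l X Y > 0 \<and> ideal_trace br l X Y > 0"
  then obtain Y where Y: "weight l Y > 0" "(\<Sum>i\<in>{2..l}. weight i Y) > 0"
    unfolding centre_weight_eq ideal_trace_eq by blast
  define t where "t = (\<Sum>i\<in>{1..l}. weight i Y)"
  have "t = weight 1 Y + (\<Sum>i\<in>{2..l}. weight i Y)"
    using l by (simp add: t_def sum.atLeast_Suc_atMost numeral_2_eq_2)
  then have t: "t > 0"
    using filiform_weights_feasible(1)[OF l, of "\<lambda>i. weight i Y", OF weight_arithmetic Y] by simp
  have "weight i ((1 / t) *\<^sub>R Y) = (1 / t) * weight i Y" for i
    by (simp add: linear_scale[OF linear_weight])
  then show "\<exists>ip. inner_product ip \<and> negative_ricci br ip"
    using t Y by (intro negative_ricci_sufficient[of "(1 / t) *\<^sub>R Y"])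
      (simp_all add: sum_divide_distrib[symmetric] t_def)
qed

end

theorem theorem4:
  fixes br :: "'a::real_vector \<Rightarrow> 'a \<Rightarrow> 'a"
    and N :: "'a set" and X :: "nat \<Rightarrow> 'a" and l :: nat
  assumes "l \<ge> 4"
    and "\<exists>B :: 'a set. finite B \<and> span B = UNIV"
    and "lie_bracket br"
    and "lie_solvable br UNIV"
    and "is_nilradical br N"
    and "standard_filiform_basis br N l X"
  shows "(\<exists>ip. inner_product ip \<and> negative_ricci br ip) \<longleftrightarrow>
         (\<exists>Y. centre_weight br l X Y > 0 \<and> ideal_trace br l X Y > 0)"
proof -
  interpret filiform_nilradical br N X l
    using assms by unfold_locales
  show ?thesis by (rule negative_ricci_iff)
qed

end
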